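(* For any group $G$, the following two assertions are equivalent. (i) $G$ is supramenable. (ii) For any ring $R$ and nonempty set $X\subseteq G$, the ring $T_G(X,R)$ has UGN if and only if $R$ has UGN.
   Context: Rings are unital; "module" means right module. A ring $S$ has unbounded generating number (UGN) if, for every positive integer $n$, there is no $S$-module epimorphism $S^n\to S^{n+1}$. A subset $X$ of a group $G$ is amenable with respect to $G$ if there is a function $\mu:\mathcal P(G)\to[0,\infty]$ such that $\mu(A\cup B)=\mu(A)+\mu(B)$ for all disjoint $A,B\subseteq G$, $\mu(gA)=\mu(A)$ for all $A\subseteq G$ and $g\in G$, and $\mu(X)=1$. A group $G$ is supramenable if every nonempty subset of $G$ is amenable with respect to $G$. For a ring $R$, a group $G$ and a nonempty subset $X\subseteq G$, the translation ring $T_G(X,R)$ is the ring of all $X\times X$ matrices $M$ over $R$ (functions $M:X\times X\to R$) for which there is a finite set $K\subseteq G$ such that $M(x,y)=0$ whenever $y\notin Kx$, with entrywise addition and the product $(MN)(x,y)=\sum_{z\in X}M(x,z)N(z,y)$ (a sum with only finitely many nonzero terms). *)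

theory Defs
  imports "HOL-Algebra.Ring" "HOL-Algebra.Coset" "HOL-Library.Extended_Nonnegative_Real"
begin

text \<open>The right module \<open>S\<^sup>n\<close>. Its elements are the functions on \<open>{..<n}\<close> with values in \<open>S\<close>,
  extended by \<open>undefined\<close>.\<close>

definition free_rmod :: "('s, 'm) ring_scheme \<Rightarrow> nat \<Rightarrow> (nat \<Rightarrow> 's) set" where
  "free_rmod S n = {..<n} \<rightarrow>\<^sub>E carrier S"

definition free_rmod_add ::
  "('s, 'm) ring_scheme \<Rightarrow> nat \<Rightarrow> (nat \<Rightarrow> 's) \<Rightarrow> (nat \<Rightarrow> 's) \<Rightarrow> (nat \<Rightarrow> 's)" where
  "free_rmod_add S n u v = (\<lambda>i\<in>{..<n}. u i \<oplus>\<^bsub>S\<^esub> v i)"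

definition free_rmod_smult ::
  "('s, 'm) ring_scheme \<Rightarrow> nat \<Rightarrow> (nat \<Rightarrow> 's) \<Rightarrow> 's \<Rightarrow> (nat \<Rightarrow> 's)" where
  "free_rmod_smult S n v s = (\<lambda>i\<in>{..<n}. v i \<otimes>\<^bsub>S\<^esub> s)"

definition free_rmod_hom ::
  "('s, 'm) ring_scheme \<Rightarrow> nat \<Rightarrow> nat \<Rightarrow> ((nat \<Rightarrow> 's) \<Rightarrow> (nat \<Rightarrow> 's)) set" where
  "free_rmod_hom S m n =
    {f. f \<in> free_rmod S m \<rightarrow> free_rmod S n \<and>
        (\<forall>u \<in> free_rmod S m. \<forall>v \<in> free_rmod S m.
           f (free_rmod_add S m u v) = free_rmod_add S n (f u) (f v)) \<and>
        (\<forall>v \<in> free_rmod S m. \<forall>s \<in> carrier S.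
           f (free_rmod_smult S m v s) = free_rmod_smult S n (f v) s)}"

text \<open>Epimorphisms of modules are the surjective homomorphisms.\<close>

definition UGN :: "('s, 'm) ring_scheme \<Rightarrow> bool" where
  "UGN S \<longleftrightarrow>
    (\<forall>n>0. \<not> (\<exists>f \<in> free_rmod_hom S n (n + 1). f ` free_rmod S n = free_rmod S (n + 1)))"

definition amenable_subset :: "('g, 'm) monoid_scheme \<Rightarrow> 'g set \<Rightarrow> bool" where
  "amenable_subset G X \<longleftrightarrow>
    (\<exists>\<mu> :: 'g set \<Rightarrow> ennreal.
       (\<forall>A B. A \<subseteq> carrier G \<longrightarrow> B \<subseteq> carrier G \<longrightarrow> A \<inter> B = {} \<longrightarrow> \<mu> (A \<union> B) = \<mu> A + \<mu> B) \<and>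
       (\<forall>A g. A \<subseteq> carrier G \<longrightarrow> g \<in> carrier G \<longrightarrow> \<mu> (g <#\<^bsub>G\<^esub> A) = \<mu> A) \<and>
       \<mu> X = 1)"

definition supramenable :: "('g, 'm) monoid_scheme \<Rightarrow> bool" where
  "supramenable G \<longleftrightarrow> (\<forall>X. X \<subseteq> carrier G \<longrightarrow> X \<noteq> {} \<longrightarrow> amenable_subset G X)"

text \<open>Matrices are functions on \<open>X \<times> X\<close>, extended by \<open>undefined\<close>. Since \<^const>\<open>finsum\<close> is
  only meaningful over finite index sets, the sum in the product ranges over the \<open>z \<in> X\<close> with
  nonzero term.\<close>

definition translation_ring ::
  "('g, 'm) monoid_scheme \<Rightarrow> 'g set \<Rightarrow> ('r, 'k) ring_scheme \<Rightarrow> ('g \<times> 'g \<Rightarrow> 'r) ring" where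
  "translation_ring G X R =
    \<lparr>carrier = {M \<in> X \<times> X \<rightarrow>\<^sub>E carrier R.
        \<exists>K. finite K \<and> K \<subseteq> carrier G \<and>
          (\<forall>x\<in>X. \<forall>y\<in>X. y \<notin> K #>\<^bsub>G\<^esub> x \<longrightarrow> M (x, y) = \<zero>\<^bsub>R\<^esub>)},
     mult = (\<lambda>M N. \<lambda>(x, y)\<in>X \<times> X.
        \<Oplus>\<^bsub>R\<^esub>z\<in>{z \<in> X. M (x, z) \<otimes>\<^bsub>R\<^esub> N (z, y) \<noteq> \<zero>\<^bsub>R\<^esub>}. M (x, z) \<otimes>\<^bsub>R\<^esub> N (z, y)),
     one = (\<lambda>(x, y)\<in>X \<times> X. if x = y then \<one>\<^bsub>R\<^esub> else \<zero>\<^bsub>R\<^esub>),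
     zero = (\<lambda>(x, y)\<in>X \<times> X. \<zero>\<^bsub>R\<^esub>),
     add = (\<lambda>M N. \<lambda>(x, y)\<in>X \<times> X. M (x, y) \<oplus>\<^bsub>R\<^esub> N (x, y))\<rparr>"

end

theory Submission
  imports Defs "HOL-Analysis.Function_Topology" "HOL-Algebra.UnivPoly"
begin

text \<open>Both properties are governed by one combinatorial notion: \<open>X\<close> is compressed if, for some \<open>n\<close>,
  there is an injection of \<open>n + 1\<close> copies of \<open>X\<close> into \<open>n\<close> copies of \<open>X\<close> that acts by left
  translations from a finite subset of \<open>G\<close> (\<open>compresses\<close>).

  A nonempty set \<open>X\<close> is amenable with respect to \<open>G\<close> if and only if it is not compressed. An
  invariant \<open>\<mu>\<close> with \<open>\<mu>(X) = 1\<close> rules out a compression, since it would give \<open>n + 1 \<le> n\<close>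
  (\<open>compresses_imp_not_amenable\<close>). If there is no compression, the infinite version of Hall's
  theorem (\<open>hall_infinite\<close>) yields, for every finite \<open>K\<close> and every \<open>n\<close>, a finite \<open>F \<subseteq> X\<close> with
  \<open>n |K F \<inter> X| < (n + 1) |F|\<close> (\<open>folner_set\<close>); a compactness argument turns these Folner sets
  into a mean on the subsets of \<open>X\<close>, which extends to an invariant measure on \<open>G\<close>
  (\<open>ex_invariant_mean\<close>, \<open>invariant_mean_extends\<close>). Asking for a compression rather than for a
  paradoxical decomposition avoids the cancellation law in Tarski's theorem.

  On the side of rings, an epimorphism \<open>S\<^sup>n \<rightarrow> S\<^sup>m\<close> amounts to an \<open>m \<times> n\<close> matrix \<open>A\<close> and an
  \<open>n \<times> m\<close> matrix \<open>B\<close> with \<open>A B = 1\<close>, because free modules are projective. Such matrices pass from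
  \<open>R\<close> to \<open>T = T_G(X, R)\<close> along the scalar matrices. A compression of \<open>X\<close> gives such matrices over
  \<open>T\<close> with \<open>m = n + 1\<close>, namely its incidence matrix and the transpose (\<open>compresses_imp_not_UGN\<close>).
  Conversely, if \<open>R\<close> has UGN and \<open>X\<close> is not compressed, cutting such matrices over \<open>T\<close> down to a
  Folner set would produce matrices over \<open>R\<close> that contradict UGN of \<open>R\<close>
  (\<open>retract_T_imp_compresses\<close>).

  So if \<open>G\<close> is supramenable, no nonempty \<open>X\<close> is compressed and UGN of \<open>R\<close> and of \<open>T\<close> are equivalent.
  If some nonempty \<open>X\<close> is not amenable, then over the field with two elements, which has UGN, the ring \<open>T\<close> does
  not have UGN.\<close>

section \<open>Hall's theorem for infinite families of finite sets\<close>

text \<open>Hall's theorem for a family of finite sets over an arbitrary index set, by Rado's argument: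
  in a family that is minimal for Hall's condition every set is a singleton. The relation \<open>D\<close>
  below collects the pairs \<open>(i, x)\<close> such that \<open>x\<close> has been deleted from \<open>A i\<close>.\<close>

lemma hall_infinite:
  fixes A :: "'i \<Rightarrow> 'a set"
  assumes fin: "\<And>i. i \<in> I \<Longrightarrow> finite (A i)"
    and hall: "\<And>F. F \<subseteq> I \<Longrightarrow> finite F \<Longrightarrow> card F \<le> card (\<Union>i\<in>F. A i)"
  shows "\<exists>f. inj_on f I \<and> (\<forall>i\<in>I. f i \<in> A i)"
proof -
  define H where "H D \<longleftrightarrow> (\<forall>F. F \<subseteq> I \<longrightarrow> finite F \<longrightarrow> card F \<le> card (\<Union>i\<in>F. A i - D `` {i}))" for D
  have "\<exists>M\<in>{D. H D}. \<forall>D\<in>{D. H D}. M \<subseteq> D \<longrightarrow> D = M"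
  proof (rule subset_Zorn_nonempty)
    show "{D. H D} \<noteq> {}" using hall by (auto simp: H_def intro!: exI[of _ "{}"])
  next
    fix \<C> assume ne: "\<C> \<noteq> {}" and ch: "subset.chain {D. H D} \<C>"
    have "H (\<Union>\<C>)"
      unfolding H_def
    proof (intro allI impI)
      fix F assume F: "F \<subseteq> I" "finite F"
      \<comment> \<open>Only finitely many deletions concern the indices in \<open>F\<close>, so one member of the chain
        performs all of them.\<close>
      have "finite (Sigma F A \<inter> \<Union>\<C>)" using F fin by blast
      then obtain D where D: "D \<in> \<C>" "Sigma F A \<inter> \<Union>\<C> \<subseteq> D"
        using finite_subset_Union_chain[of "Sigma F A \<inter> \<Union>\<C>" \<C> "{D. H D}"] ne ch by blast
      have "A i - D `` {i} = A i - (\<Union>\<C>) `` {i}" if "i \<in> F" for i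
        using D that by blast
      hence "(\<Union>i\<in>F. A i - (\<Union>\<C>) `` {i}) = (\<Union>i\<in>F. A i - D `` {i})" by blast
      moreover have "H D" using D ch by (auto simp: subset.chain_def)
      ultimately show "card F \<le> card (\<Union>i\<in>F. A i - (\<Union>\<C>) `` {i})"
        using F by (simp add: H_def)
    qed
    thus "\<Union>\<C> \<in> {D. H D}" by simp
  qed
  then obtain M where M: "H M" and max: "\<And>D. H D \<Longrightarrow> M \<subseteq> D \<Longrightarrow> D = M" by blast
  define B where "B i = A i - M `` {i}" for i
  have finB: "finite (B i)" if "i \<in> I" for i using fin that by (simp add: B_def)
  have hallB: "card F \<le> card (\<Union>i\<in>F. B i)" if "F \<subseteq> I" "finite F" for F
    using M that by (simp add: H_def B_def)
  \<comment> \<open>By maximality, deleting any further element \<open>x\<close> of \<open>B i\<close> breaks Hall's condition at some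
    \<open>insert i F\<close>.\<close>
  have crit: "\<exists>F. F \<subseteq> I \<and> finite F \<and> i \<notin> F \<and> card ((\<Union>j\<in>F. B j) \<union> (B i - {x})) \<le> card F"
    if i: "i \<in> I" and x: "x \<in> B i" for i x
  proof -
    have "\<not> H (insert (i,x) M)" using max[of "insert (i,x) M"] x by (auto simp: B_def)
    then obtain F where F: "F \<subseteq> I" "finite F"
      and lt: "card (\<Union>j\<in>F. A j - insert (i,x) M `` {j}) < card F"
      by (auto simp: H_def not_le)
    have eq: "A j - insert (i,x) M `` {j} = (if j = i then B i - {x} else B j)" for j
      by (auto simp: B_def)
    have iF: "i \<in> F"
    proof (rule ccontr)
      assume "i \<notin> F"
      hence "(\<Union>j\<in>F. A j - insert (i,x) M `` {j}) = (\<Union>j\<in>F. B j)" unfolding eq by auto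
      thus False using lt hallB[OF F] by simp
    qed
    have "(\<Union>j\<in>F. A j - insert (i,x) M `` {j}) = (\<Union>j\<in>F-{i}. B j) \<union> (B i - {x})"
      unfolding eq using iF by (auto split: if_splits)
    hence "card ((\<Union>j\<in>F-{i}. B j) \<union> (B i - {x})) \<le> card (F-{i})"
      using lt iF F by simp
    thus ?thesis using F by (intro exI[of _ "F-{i}"]) auto
  qed
  have one: "\<exists>x. B i = {x}" if i: "i \<in> I" for i
  proof -
    have "card (B i) \<ge> 1" using hallB[of "{i}"] i by simp
    then obtain x where x: "x \<in> B i" by fastforce
    have "y = x" if y: "y \<in> B i" for y
    proof (rule ccontr)
      assume ne: "y \<noteq> x"
      obtain F where F: "F \<subseteq> I" "finite F" "i \<notin> F"
        and cF: "card ((\<Union>j\<in>F. B j) \<union> (B i - {x})) \<le> card F" using crit[OF i x] by blast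
      obtain E where E: "E \<subseteq> I" "finite E" "i \<notin> E"
        and cE: "card ((\<Union>j\<in>E. B j) \<union> (B i - {y})) \<le> card E" using crit[OF i y] by blast
      \<comment> \<open>If \<open>x\<close> and \<open>y\<close> were distinct elements of \<open>B i\<close>, counting the union and the intersection
        of the two critical sets would contradict Hall's condition.\<close>
      let ?U = "(\<Union>j\<in>F. B j) \<union> (B i - {x})" and ?V = "(\<Union>j\<in>E. B j) \<union> (B i - {y})"
      have fU: "finite ?U" "finite ?V" using F E finB i by (auto intro!: finite_UN_I)
      have "card (insert i (F \<union> E)) \<le> card (\<Union>j\<in>insert i (F \<union> E). B j)"
        using F E i by (intro hallB) auto
      also have "\<dots> \<le> card (?U \<union> ?V)"
        using ne fU by (intro card_mono) auto
      finally have 1: "card (F \<union> E) + 1 \<le> card (?U \<union> ?V)" using F E by simp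
      have "card (F \<inter> E) \<le> card (\<Union>j\<in>F \<inter> E. B j)"
        using F E by (intro hallB) auto
      also have "\<dots> \<le> card (?U \<inter> ?V)" using fU by (intro card_mono) auto
      finally have "card (F \<union> E) + card (F \<inter> E) + 1 \<le> card ?U + card ?V"
        using 1 card_Un_Int[OF fU] by linarith
      thus False using cF cE card_Un_Int[OF F(2) E(2)] by linarith
    qed
    thus ?thesis using x by blast
  qed
  then obtain f where f: "\<And>i. i \<in> I \<Longrightarrow> B i = {f i}" by metis
  have "inj_on f I"
  proof (rule inj_onI, rule ccontr)
    fix i j assume ij: "i \<in> I" "j \<in> I" "f i = f j" "i \<noteq> j"
    thus False using hallB[of "{i,j}"] f by simp
  qed
  moreover have "f i \<in> A i" if "i \<in> I" for i using f[OF that] by (auto simp: B_def)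
  ultimately show ?thesis by blast
qed

section \<open>Compressions and Folner sets\<close>

text \<open>\<^term>\<open>compresses G X n\<close> says that \<open>n + 1\<close> disjoint copies of \<open>X\<close> embed into \<open>n\<close> copies of
  \<open>X\<close> by a map that moves the first coordinate by left translations from a finite set \<open>K\<close>. Copies
  are indexed by \<open>{..n}\<close> and \<open>{..<n}\<close>.\<close>

definition compresses :: "('g, 'm) monoid_scheme \<Rightarrow> 'g set \<Rightarrow> nat \<Rightarrow> bool" where
  "compresses G X n \<longleftrightarrow>
    (\<exists>K f. finite K \<and> K \<subseteq> carrier G \<and> inj_on f (X \<times> {..n}) \<and>
       (\<forall>x\<in>X. \<forall>i\<le>n. f (x, i) \<in> (X \<inter> (K #>\<^bsub>G\<^esub> x)) \<times> {..<n}))"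

text \<open>The part of \<open>K F\<close> that lies in \<open>X\<close>.\<close>

definition neighbourhood :: "('g, 'm) monoid_scheme \<Rightarrow> 'g set \<Rightarrow> 'g set \<Rightarrow> 'g set \<Rightarrow> 'g set" where
  "neighbourhood G X K F = (\<Union>x\<in>F. X \<inter> (K #>\<^bsub>G\<^esub> x))"

lemma finite_neighbourhood:
  "finite K \<Longrightarrow> finite F \<Longrightarrow> finite (neighbourhood G X K F)"
  by (auto simp: neighbourhood_def r_coset_def)

text \<open>If \<open>X\<close> cannot be compressed, Hall's condition fails for the bipartite graph joining \<open>(x, i)\<close>
  to all \<open>(k x, j)\<close> with \<open>k \<in> K\<close> and \<open>k x \<in> X\<close>. A finite set violating it projects to a Folner
  set.\<close>

lemma folner_set:
  assumes nc: "\<not> compresses G X n" and K: "finite K" "K \<subseteq> carrier G"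
  shows "\<exists>F \<subseteq> X. finite F \<and> n * card (neighbourhood G X K F) < (n + 1) * card F"
proof (rule ccontr)
  assume "\<not> ?thesis"
  hence ge: "(n + 1) * card F \<le> n * card (neighbourhood G X K F)" if "F \<subseteq> X" "finite F" for F
    using that by (auto simp: not_less)
  have "\<exists>f. inj_on f (X \<times> {..n}) \<and>
    (\<forall>p\<in>X \<times> {..n}. f p \<in> (X \<inter> (K #>\<^bsub>G\<^esub> fst p)) \<times> {..<n})"
  proof (rule hall_infinite)
    fix p :: "'a \<times> nat" show "finite ((X \<inter> (K #>\<^bsub>G\<^esub> fst p)) \<times> {..<n})"
      using K by (auto simp: r_coset_def)
  next
    fix E assume E: "E \<subseteq> X \<times> {..n}" "finite E"
    let ?F = "fst ` E"
    have "card E \<le> card (?F \<times> {..n})"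
      using E by (intro card_mono) (auto intro!: finite_cartesian_product simp: image_iff subset_eq, metis fst_conv)
    also have "\<dots> \<le> n * card (neighbourhood G X K ?F)"
    proof -
      have "?F \<subseteq> X" using E by auto
      thus ?thesis using ge[of ?F] E by (simp add: card_cartesian_product mult.commute)
    qed
    also have "\<dots> = card (neighbourhood G X K ?F \<times> {..<n})"
      by (simp add: card_cartesian_product)
    also have "neighbourhood G X K ?F \<times> {..<n} = (\<Union>p\<in>E. (X \<inter> (K #>\<^bsub>G\<^esub> fst p)) \<times> {..<n})"
      by (auto simp: neighbourhood_def)
    finally show "card E \<le> card (\<Union>p\<in>E. (X \<inter> (K #>\<^bsub>G\<^esub> fst p)) \<times> {..<n})" .
  qed
  hence "compresses G X n" unfolding compresses_def using K by fastforce
  thus False using nc by simp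
qed

text \<open>Cutting the \<open>n + 1\<close> copies into pieces on which the compressing map is a fixed translation
  into a fixed target copy shows \<open>(n + 1) \<mu>(X) \<le> n \<mu>(X)\<close> for every invariant \<open>\<mu>\<close>.\<close>

lemma compresses_imp_not_amenable:
  assumes "group G" and X: "X \<subseteq> carrier G" and c: "compresses G X n"
  shows "\<not> amenable_subset G X"
proof
  interpret group G by fact
  assume "amenable_subset G X"
  then obtain \<mu> :: "_ \<Rightarrow> ennreal" where
    add: "\<And>A B. A \<subseteq> carrier G \<Longrightarrow> B \<subseteq> carrier G \<Longrightarrow> A \<inter> B = {} \<Longrightarrow> \<mu> (A \<union> B) = \<mu> A + \<mu> B"
    and inv: "\<And>A g. A \<subseteq> carrier G \<Longrightarrow> g \<in> carrier G \<Longrightarrow> \<mu> (g <#\<^bsub>G\<^esub> A) = \<mu> A"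
    and one: "\<mu> X = 1"
    unfolding amenable_subset_def by blast
  \<comment> \<open>The values of \<open>\<mu>\<close> may be infinite, so \<open>\<mu> {} = 0\<close> needs a set of finite measure.\<close>
  have "1 + \<mu> {} = (1 :: ennreal)" using add[of X "{}"] X one by simp
  hence empty: "\<mu> {} = 0"
    by (metis add.right_neutral ennreal_add_left_cancel infinity_ennreal_def ennreal_one_neq_top)
  have sum: "\<mu> (\<Union>i\<in>I. A i) = (\<Sum>i\<in>I. \<mu> (A i))"
    if "finite I" "disjoint_family_on A I" "\<And>i. i \<in> I \<Longrightarrow> A i \<subseteq> carrier G" for A :: "'i \<Rightarrow> 'a set" and I
    using that
  proof (induction I)
    case (insert i I)
    have "A i \<inter> (\<Union>j\<in>I. A j) = {}"
      using insert.prems(1) insert.hyps by (auto simp: disjoint_family_on_def)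
    hence "\<mu> (A i \<union> (\<Union>j\<in>I. A j)) = \<mu> (A i) + \<mu> (\<Union>j\<in>I. A j)"
      using insert.prems by (intro add) auto
    thus ?case using insert by (auto simp: disjoint_family_on_def)
  qed (simp add: empty)
  have mono: "\<mu> A \<le> \<mu> X" if "A \<subseteq> X" for A
  proof -
    have "\<mu> (A \<union> (X - A)) = \<mu> A + \<mu> (X - A)" using that X by (intro add) auto
    thus ?thesis using that by (simp add: Un_absorb1)
  qed
  obtain K f where K: "finite K" "K \<subseteq> carrier G" and inj: "inj_on f (X \<times> {..n})"
    and f: "\<And>x i. x \<in> X \<Longrightarrow> i \<le> n \<Longrightarrow> f (x, i) \<in> (X \<inter> (K #>\<^bsub>G\<^esub> x)) \<times> {..<n}"
    using c unfolding compresses_def by blast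
  define P where "P k i j = {x \<in> X. f (x, i) = (k \<otimes>\<^bsub>G\<^esub> x, j)}" for k i j
  have PX: "P k i j \<subseteq> X" for k i j by (auto simp: P_def)
  have PG: "P k i j \<subseteq> carrier G" for k i j using PX X by blast
  have src: "1 = (\<Sum>p\<in>K \<times> {..<n}. \<mu> (P (fst p) i (snd p)))" if i: "i \<le> n" for i
  proof -
    have "(\<Union>p\<in>K \<times> {..<n}. P (fst p) i (snd p)) = X"
    proof (intro equalityI subsetI)
      fix x assume x: "x \<in> X"
      obtain k j where "k \<in> K" "j < n" "f (x,i) = (k \<otimes>\<^bsub>G\<^esub> x, j)"
        using f[OF x i] by (auto simp: r_coset_def)
      thus "x \<in> (\<Union>p\<in>K \<times> {..<n}. P (fst p) i (snd p))" using x by (force simp: P_def)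
    qed (auto simp: P_def)
    moreover have "disjoint_family_on (\<lambda>p. P (fst p) i (snd p)) (K \<times> {..<n})"
      unfolding disjoint_family_on_def
    proof (intro ballI impI)
      fix p q assume pq: "p \<in> K \<times> {..<n}" "q \<in> K \<times> {..<n}" "p \<noteq> q"
      show "P (fst p) i (snd p) \<inter> P (fst q) i (snd q) = {}"
      proof (rule ccontr)
        assume "P (fst p) i (snd p) \<inter> P (fst q) i (snd q) \<noteq> {}"
        then obtain x where "x \<in> P (fst p) i (snd p)" "x \<in> P (fst q) i (snd q)" by blast
        hence x: "x \<in> X" "fst p \<otimes>\<^bsub>G\<^esub> x = fst q \<otimes>\<^bsub>G\<^esub> x" "snd p = snd q"
          by (simp_all add: P_def)
        have "fst p = fst q" by (rule right_cancel[THEN iffD1, OF _ _ _ x(2)]) (use x pq K X in auto)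
        thus False using x(3) pq(3) by (simp add: prod_eq_iff)
      qed
    qed
    ultimately show ?thesis
      using sum[of "K \<times> {..<n}" "\<lambda>p. P (fst p) i (snd p)"] K PG one by simp
  qed
  have tgt: "(\<Sum>p\<in>K \<times> {..n}. \<mu> (P (fst p) (snd p) j)) \<le> 1" for j
  proof -
    let ?Q = "\<lambda>p. fst p <#\<^bsub>G\<^esub> P (fst p) (snd p) j"
    have QX: "?Q p \<subseteq> X" if "p \<in> K \<times> {..n}" for p
    proof
      fix y assume "y \<in> ?Q p"
      then obtain x where x: "x \<in> X" "f (x, snd p) = (y, j)"
        by (auto simp: l_coset_def P_def)
      thus "y \<in> X" using f[of x "snd p"] that by auto
    qed
    have "disjoint_family_on ?Q (K \<times> {..n})"
      unfolding disjoint_family_on_def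
    proof (intro ballI impI)
      fix p q assume pq: "p \<in> K \<times> {..n}" "q \<in> K \<times> {..n}" "p \<noteq> q"
      show "?Q p \<inter> ?Q q = {}"
      proof (rule ccontr)
        assume "?Q p \<inter> ?Q q \<noteq> {}"
        then obtain z where z: "z \<in> ?Q p" "z \<in> ?Q q" by blast
        from z(1) obtain x where x: "x \<in> X" "z = fst p \<otimes>\<^bsub>G\<^esub> x" "f (x, snd p) = (z, j)"
          by (auto simp: l_coset_def P_def)
        from z(2) obtain y where y: "y \<in> X" "z = fst q \<otimes>\<^bsub>G\<^esub> y" "f (y, snd q) = (z, j)"
          by (auto simp: l_coset_def P_def)
        have "f (x, snd p) = f (y, snd q)" using x(3) y(3) by simp
        from inj_onD[OF inj this] have "(x, snd p) = (y, snd q)" using pq x(1) y(1) by auto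
        hence eq: "x = y" "snd p = snd q" by auto
        have m: "fst p \<otimes>\<^bsub>G\<^esub> x = fst q \<otimes>\<^bsub>G\<^esub> x" using x(2) y(2) eq(1) by simp
        have "fst p = fst q"
          by (rule right_cancel[THEN iffD1, OF _ _ _ m]) (use x(1) pq K X in auto)
        thus False using eq(2) pq(3) by (simp add: prod_eq_iff)
      qed
    qed
    hence "(\<Sum>p\<in>K \<times> {..n}. \<mu> (?Q p)) = \<mu> (\<Union>p\<in>K \<times> {..n}. ?Q p)"
      using K QX X by (subst sum) blast+
    also have "\<dots> \<le> 1" using QX mono[of "\<Union>p\<in>K \<times> {..n}. ?Q p"] one by auto
    finally have le: "(\<Sum>p\<in>K \<times> {..n}. \<mu> (?Q p)) \<le> 1" .
    have "(\<Sum>p\<in>K \<times> {..n}. \<mu> (?Q p)) = (\<Sum>p\<in>K \<times> {..n}. \<mu> (P (fst p) (snd p) j))"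
      using K PG by (intro sum.cong refl inv) auto
    thus ?thesis using le by simp
  qed
  have "of_nat (n + 1) = (\<Sum>i\<in>{..n}. 1 :: ennreal)" by simp
  also have "\<dots> = (\<Sum>i\<in>{..n}. \<Sum>k\<in>K. \<Sum>j\<in>{..<n}. \<mu> (P k i j))"
    using src by (intro sum.cong refl) (simp add: sum.cartesian_product case_prod_beta)
  also have "\<dots> = (\<Sum>i\<in>{..n}. \<Sum>j\<in>{..<n}. \<Sum>k\<in>K. \<mu> (P k i j))"
    by (intro sum.cong refl sum.swap)
  also have "\<dots> = (\<Sum>j\<in>{..<n}. \<Sum>i\<in>{..n}. \<Sum>k\<in>K. \<mu> (P k i j))"
    by (rule sum.swap)
  also have "\<dots> = (\<Sum>j\<in>{..<n}. \<Sum>k\<in>K. \<Sum>i\<in>{..n}. \<mu> (P k i j))"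
    by (intro sum.cong refl sum.swap)
  also have "\<dots> \<le> (\<Sum>j\<in>{..<n}. 1)"
    using tgt by (intro sum_mono) (simp add: sum.cartesian_product case_prod_beta)
  also have "\<dots> = of_nat n" by simp
  finally have "(of_nat (n + 1) :: ennreal) \<le> of_nat n" .
  thus False by (simp only: of_nat_le_iff)
qed

section \<open>Invariant measures from Folner sets\<close>

text \<open>A finitely additive probability measure on the subsets of \<open>X\<close> that is invariant under those
  translations which stay inside \<open>X\<close>. Its values on sets not contained in \<open>X\<close> carry no meaning.\<close>

definition invariant_mean :: "('g, 'm) monoid_scheme \<Rightarrow> 'g set \<Rightarrow> ('g set \<Rightarrow> real) \<Rightarrow> bool" where
  "invariant_mean G X m \<longleftrightarrow> m X = 1 \<and> (\<forall>A. 0 \<le> m A) \<and>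
     (\<forall>A B. A \<subseteq> X \<longrightarrow> B \<subseteq> X \<longrightarrow> A \<inter> B = {} \<longrightarrow> m (A \<union> B) = m A + m B) \<and>
     (\<forall>g A. g \<in> carrier G \<longrightarrow> A \<subseteq> X \<longrightarrow> g <#\<^bsub>G\<^esub> A \<subseteq> X \<longrightarrow> m (g <#\<^bsub>G\<^esub> A) = m A)"

lemma (in group) l_cancel:
  assumes "g \<otimes> a = g \<otimes> b" "g \<in> carrier G" "a \<in> carrier G" "b \<in> carrier G"
  shows "a = b"
  using assms by (simp add: Units_l_cancel[unfolded Units_eq])

text \<open>Counting measures on Folner sets are approximately invariant. The functions that are invariant
  up to \<open>1 / (n + 1)\<close> under \<open>K\<close> form a closed subset \<open>C (K, n)\<close> of the compact cube, and these
  closed sets have the finite intersection property; a point common to all of them is an invariant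
  mean.\<close>

lemma ex_invariant_mean:
  assumes "group G" and X: "X \<subseteq> carrier G" and nc: "\<And>n. \<not> compresses G X n"
  shows "\<exists>m. invariant_mean G X m"
proof -
  interpret group G by fact
  define S :: "('a set \<Rightarrow> real) set" where "S = Pi\<^sub>E UNIV (\<lambda>_. {0..1})"
  define I where "I = {(K, n :: nat). finite K \<and> K \<subseteq> carrier G}"
  define C where "C = (\<lambda>(K, n). {m :: 'a set \<Rightarrow> real. m X = 1 \<and>
     (\<forall>A B. A \<subseteq> X \<longrightarrow> B \<subseteq> X \<longrightarrow> A \<inter> B = {} \<longrightarrow> m (A \<union> B) = m A + m B) \<and>
     (\<forall>g A. g \<in> K \<longrightarrow> A \<subseteq> X \<longrightarrow> g <#\<^bsub>G\<^esub> A \<subseteq> X \<longrightarrow> m A \<le> m (g <#\<^bsub>G\<^esub> A) + 1 / real (n + 1))})"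
  have ne: "S \<inter> C (K, n) \<noteq> {}" if K: "finite K" "K \<subseteq> carrier G" for K n
  proof -
    let ?K = "insert \<one>\<^bsub>G\<^esub> K"
    \<comment> \<open>With \<open>n + 1\<close> in place of \<open>n\<close>, translation by an element of \<open>K\<close> moves at most a proportion of
      \<open>1 / (n + 1)\<close> of \<open>F\<close> out of \<open>F\<close>; the unit of \<open>G\<close> ensures that \<open>F\<close> lies in its neighbourhood.\<close>
    obtain F where F: "F \<subseteq> X" "finite F"
      and lt: "(n + 1) * card (neighbourhood G X ?K F) < (n + 1 + 1) * card F"
      using folner_set[OF nc[of "n + 1"], of ?K] K by auto
    let ?N = "neighbourhood G X ?K F"
    have finN: "finite ?N" using K F by (intro finite_neighbourhood) auto
    have FN: "F \<subseteq> ?N" using F X by (force simp: neighbourhood_def r_coset_def)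
    have pos: "card F > 0" using lt by (cases "card F") auto
    define m where "m A = real (card (A \<inter> F)) / real (card F)" for A
    have "card (A \<inter> F) \<le> card F" for A using F by (intro card_mono) auto
    moreover have "F \<noteq> {}" using pos by (metis card.empty less_irrefl)
    ultimately have "m \<in> S" by (auto simp: S_def m_def divide_le_eq_1)
    moreover have "m X = 1" using F pos by (auto simp: m_def Int_absorb1)
    moreover have "m (A \<union> B) = m A + m B" if "A \<inter> B = {}" for A B
    proof -
      have "card ((A \<inter> F) \<union> (B \<inter> F)) = card (A \<inter> F) + card (B \<inter> F)"
        using that F by (intro card_Un_disjoint) auto
      thus ?thesis by (simp add: m_def Int_Un_distrib2 add_divide_distrib)
    qed
    moreover have "m A \<le> m (g <#\<^bsub>G\<^esub> A) + 1 / real (n + 1)"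
      if g: "g \<in> K" and A: "A \<subseteq> X" "g <#\<^bsub>G\<^esub> A \<subseteq> X" for g A
    proof -
      have "card (A \<inter> F) = card ((\<lambda>x. g \<otimes>\<^bsub>G\<^esub> x) ` (A \<inter> F))"
        using g K A X by (intro card_image[symmetric] inj_onI) (metis IntD1 l_cancel subsetD)
      also have "\<dots> \<le> card (((g <#\<^bsub>G\<^esub> A) \<inter> F) \<union> (?N - F))"
      proof (rule card_mono)
        show "finite (((g <#\<^bsub>G\<^esub> A) \<inter> F) \<union> (?N - F))" using finN F by auto
        show "(\<lambda>x. g \<otimes>\<^bsub>G\<^esub> x) ` (A \<inter> F) \<subseteq> ((g <#\<^bsub>G\<^esub> A) \<inter> F) \<union> (?N - F)"
          using A g by (fastforce simp: neighbourhood_def r_coset_def l_coset_def)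
      qed
      also have "\<dots> \<le> card ((g <#\<^bsub>G\<^esub> A) \<inter> F) + card (?N - F)" by (rule card_Un_le)
      also have "card (?N - F) = card ?N - card F" using FN F by (simp add: card_Diff_subset)
      finally have le: "real (card (A \<inter> F)) \<le> real (card ((g <#\<^bsub>G\<^esub> A) \<inter> F)) + (real (card ?N) - real (card F))"
        using card_mono[OF finN FN] by linarith
      have "real (n + 1) * real (card ?N) \<le> real (n + 1) * real (card F) + real (card F)"
        using lt by (simp flip: of_nat_mult of_nat_add del: of_nat_Suc add: algebra_simps)
      hence "real (card ?N) - real (card F) \<le> real (card F) / real (n + 1)"
        by (simp add: field_simps)
      hence "real (card (A \<inter> F)) \<le> real (card ((g <#\<^bsub>G\<^esub> A) \<inter> F)) + real (card F) / real (n + 1)"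
        using le by linarith
      hence "real (card (A \<inter> F)) / real (card F) \<le>
          (real (card ((g <#\<^bsub>G\<^esub> A) \<inter> F)) + real (card F) / real (n + 1)) / real (card F)"
        by (rule divide_right_mono) simp
      thus ?thesis using pos by (simp add: m_def add_divide_distrib)
    qed
    ultimately have "m \<in> S \<inter> C (K, n)" by (simp add: C_def)
    thus ?thesis by blast
  qed
  have "S \<inter> (\<Inter>i\<in>I. C i) \<noteq> {}"
  proof (rule compact_imp_fip_image)
    have "compactin (product_topology (\<lambda>_. euclidean) UNIV) S"
      unfolding S_def compactin_PiE by simp
    thus "compact S" by (simp add: euclidean_product_topology)
  next
    fix i show "closed (C i)"
      unfolding C_def case_prod_beta
      by (intro closed_Collect_conj closed_Collect_all closed_Collect_imp closed_Collect_eq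
          closed_Collect_le continuous_intros continuous_on_product_coordinates open_Collect_const)
  next
    fix J assume J: "finite J" "J \<subseteq> I"
    define K where "K = (\<Union>j\<in>J. fst j)"
    define n where "n = Max (insert 0 (snd ` J))"
    have "C (K, n) \<subseteq> C j" if j: "j \<in> J" for j
    proof -
      have K': "fst j \<subseteq> K" using j by (auto simp: K_def)
      have "snd j \<le> n" unfolding n_def using J j by (intro Max_ge) auto
      hence "1 / real (n + 1) \<le> 1 / real (snd j + 1)" by (intro divide_left_mono) auto
      hence weaken: "a \<le> b + 1 / real (snd j + 1)" if "a \<le> b + 1 / real (n + 1)" for a b
        using that by linarith
      show ?thesis
      proof
        fix m assume m: "m \<in> C (K, n)"
        have "m A \<le> m (g <#\<^bsub>G\<^esub> A) + 1 / real (snd j + 1)"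
          if "g \<in> fst j" "A \<subseteq> X" "g <#\<^bsub>G\<^esub> A \<subseteq> X" for g A
          using m that K' by (intro weaken) (auto simp: C_def)
        thus "m \<in> C j" using m unfolding C_def case_prod_beta by simp
      qed
    qed
    moreover have "S \<inter> C (K, n) \<noteq> {}"
    proof (rule ne)
      have "finite (fst j)" "fst j \<subseteq> carrier G" if "j \<in> J" for j
        using subsetD[OF J(2) that] by (auto simp: I_def)
      thus "finite K" "K \<subseteq> carrier G" unfolding K_def using J(1) by blast+
    qed
    ultimately show "S \<inter> (\<Inter>i\<in>J. C i) \<noteq> {}" by blast
  qed
  then obtain m where m: "m \<in> S" "\<And>K n. finite K \<Longrightarrow> K \<subseteq> carrier G \<Longrightarrow> m \<in> C (K, n)"
    by (auto simp: I_def)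
  have le: "m A \<le> m (g <#\<^bsub>G\<^esub> A)" if g: "g \<in> carrier G" and A: "A \<subseteq> X" "g <#\<^bsub>G\<^esub> A \<subseteq> X" for g A
  proof (rule field_le_epsilon)
    fix e :: real assume "e > 0"
    then obtain n where n: "1 / real (n + 1) < e" using nat_approx_posE[of e] by auto
    have "m A \<le> m (g <#\<^bsub>G\<^esub> A) + 1 / real (n + 1)"
      using m(2)[of "{g}" n] g A by (auto simp: C_def)
    thus "m A \<le> m (g <#\<^bsub>G\<^esub> A) + e" using n by linarith
  qed
  have "m (g <#\<^bsub>G\<^esub> A) = m A" if g: "g \<in> carrier G" and A: "A \<subseteq> X" "g <#\<^bsub>G\<^esub> A \<subseteq> X" for g A
  proof -
    have "inv\<^bsub>G\<^esub> g <#\<^bsub>G\<^esub> (g <#\<^bsub>G\<^esub> A) = A"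
      using g A X by (simp add: lcos_m_assoc lcos_mult_one)
    thus ?thesis using le[of g A] le[of "inv\<^bsub>G\<^esub> g" "g <#\<^bsub>G\<^esub> A"] g A by simp
  qed
  moreover have "m A \<ge> 0" for A using m(1) by (auto simp: S_def PiE_iff)
  ultimately show ?thesis
    using m(2)[of "{}" 0] unfolding invariant_mean_def C_def by auto
qed

text \<open>An invariant mean on \<open>X\<close> extends to an invariant measure on \<open>G\<close>: the measure of \<open>A\<close> is the
  supremum of the total means of finite families of disjoint parts \<open>P k\<close> of \<open>A\<close>, each
  carried into \<open>X\<close> by its index \<open>k\<close>. The supremum may be infinite. On subsets of \<open>X\<close> partial
  invariance prevents it from exceeding the mean.\<close>

lemma invariant_mean_extends:
  assumes "group G" and X: "X \<subseteq> carrier G" and im: "invariant_mean G X m"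
  shows "amenable_subset G X"
proof -
  interpret group G by fact
  have mX: "m X = 1" and pos: "\<And>A. 0 \<le> m A"
    and add: "\<And>A B. A \<subseteq> X \<Longrightarrow> B \<subseteq> X \<Longrightarrow> A \<inter> B = {} \<Longrightarrow> m (A \<union> B) = m A + m B"
    and inv: "\<And>g A. g \<in> carrier G \<Longrightarrow> A \<subseteq> X \<Longrightarrow> g <#\<^bsub>G\<^esub> A \<subseteq> X \<Longrightarrow> m (g <#\<^bsub>G\<^esub> A) = m A"
    using im unfolding invariant_mean_def by blast+
  define D where "D A = {(K, P). finite K \<and> K \<subseteq> carrier G \<and> disjoint_family_on P K \<and>
    (\<forall>k\<in>K. P k \<subseteq> A \<and> k <#\<^bsub>G\<^esub> P k \<subseteq> X)}" for A
  define v where "v = (\<lambda>(K, P). \<Sum>k\<in>K. m (k <#\<^bsub>G\<^esub> P k))"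
  define \<mu> where "\<mu> A = (SUP d\<in>D A. ennreal (v d))" for A
  have vpos: "v d \<ge> 0" for d by (auto simp: v_def pos intro!: sum_nonneg split: prod.split)
  have empty: "m {} = 0" using add[of "{}" "{}"] by simp
  have lc_Un: "g <#\<^bsub>G\<^esub> (A \<union> B) = (g <#\<^bsub>G\<^esub> A) \<union> (g <#\<^bsub>G\<^esub> B)" for g A B
    by (auto simp: l_coset_def)
  have lc_add: "m (g <#\<^bsub>G\<^esub> (A \<union> B)) = m (g <#\<^bsub>G\<^esub> A) + m (g <#\<^bsub>G\<^esub> B)"
    if "g \<in> carrier G" "A \<subseteq> carrier G" "B \<subseteq> carrier G" "A \<inter> B = {}"
      "g <#\<^bsub>G\<^esub> A \<subseteq> X" "g <#\<^bsub>G\<^esub> B \<subseteq> X" for g A B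
  proof -
    have "(g <#\<^bsub>G\<^esub> A) \<inter> (g <#\<^bsub>G\<^esub> B) = {}"
    proof (rule ccontr)
      assume "(g <#\<^bsub>G\<^esub> A) \<inter> (g <#\<^bsub>G\<^esub> B) \<noteq> {}"
      then obtain z where "z \<in> g <#\<^bsub>G\<^esub> A" "z \<in> g <#\<^bsub>G\<^esub> B" by blast
      then obtain a b where ab: "a \<in> A" "b \<in> B" "z = g \<otimes>\<^bsub>G\<^esub> a" "z = g \<otimes>\<^bsub>G\<^esub> b"
        by (auto simp: l_coset_def)
      hence "g \<otimes>\<^bsub>G\<^esub> a = g \<otimes>\<^bsub>G\<^esub> b" by simp
      moreover have "a \<in> carrier G" "b \<in> carrier G" using ab that by auto
      ultimately have "a = b" using l_cancel that(1) by blast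
      thus False using ab that(4) by blast
    qed
    thus ?thesis unfolding lc_Un using that by (intro add) auto
  qed
  have le1: "v d \<le> 1" if d: "d \<in> D X" for d
  proof -
    obtain K P where KP: "d = (K, P)" by fastforce
    have K: "finite K" "K \<subseteq> carrier G" "disjoint_family_on P K"
      and P: "\<And>k. k \<in> K \<Longrightarrow> P k \<subseteq> X \<and> k <#\<^bsub>G\<^esub> P k \<subseteq> X"
      using d by (auto simp: D_def KP)
    have "(\<Sum>k\<in>L. m (P k)) = m (\<Union>k\<in>L. P k)" if "L \<subseteq> K" for L
      using finite_subset[OF that K(1)] that
    proof (induction L)
      case (insert k L)
      have "P k \<inter> (\<Union>j\<in>L. P j) = {}"
        using insert.prems insert.hyps(2) K(3) by (force simp: disjoint_family_on_def)
      hence "m (P k \<union> (\<Union>j\<in>L. P j)) = m (P k) + m (\<Union>j\<in>L. P j)"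
        using insert P by (intro add) auto
      thus ?case using insert by simp
    qed (simp add: empty)
    moreover have "m (\<Union>k\<in>K. P k) + m (X - (\<Union>k\<in>K. P k)) = m X"
      using P by (subst add[symmetric]) (auto intro!: arg_cong[of _ _ m])
    moreover have "v d = (\<Sum>k\<in>K. m (P k))"
      unfolding v_def KP using K P inv by (auto intro!: sum.cong)
    ultimately show ?thesis using mX pos[of "X - (\<Union>k\<in>K. P k)"] by auto
  qed
  have "\<mu> X = 1"
  proof (rule antisym)
    show "\<mu> X \<le> 1" unfolding \<mu>_def using le1 by (auto intro!: SUP_least)
    have "({\<one>\<^bsub>G\<^esub>}, \<lambda>_. X) \<in> D X" "v ({\<one>\<^bsub>G\<^esub>}, \<lambda>_. X) = 1"
      using X mX by (auto simp: D_def v_def lcos_mult_one disjoint_family_on_def)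
    thus "1 \<le> \<mu> X" unfolding \<mu>_def by (metis SUP_upper ennreal_1)
  qed
  moreover have "\<mu> (g <#\<^bsub>G\<^esub> A) = \<mu> A" if A: "A \<subseteq> carrier G" and g: "g \<in> carrier G" for A g
  proof -
    have le: "\<mu> A \<le> \<mu> (g <#\<^bsub>G\<^esub> A)" if A: "A \<subseteq> carrier G" and g: "g \<in> carrier G" for A g
      unfolding \<mu>_def
    proof (rule SUP_mono)
      fix d assume d: "d \<in> D A"
      obtain K P where KP: "d = (K, P)" by fastforce
      have K: "finite K" "K \<subseteq> carrier G" "disjoint_family_on P K"
        and P: "\<And>k. k \<in> K \<Longrightarrow> P k \<subseteq> A \<and> k <#\<^bsub>G\<^esub> P k \<subseteq> X"
        using d by (auto simp: D_def KP)
      \<comment> \<open>The part \<open>P k\<close> of \<open>A\<close> becomes the part \<open>g P k\<close> of \<open>g A\<close>, which \<open>k g\<^sup>-\<^sup>1\<close> carries to the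
        same subset of \<open>X\<close>.\<close>
      define h where "h k = k \<otimes>\<^bsub>G\<^esub> inv\<^bsub>G\<^esub> g" for k
      define Q where "Q k = g <#\<^bsub>G\<^esub> P (k \<otimes>\<^bsub>G\<^esub> g)" for k
      have hg: "h k \<otimes>\<^bsub>G\<^esub> g = k" if "k \<in> K" for k
        using that K g by (simp add: h_def m_assoc subset_eq)
      have hG: "h k \<in> carrier G" if "k \<in> K" for k using that K g by (auto simp: h_def)
      have inj: "inj_on h K" by (metis hg inj_onI)
      have PG: "P k \<subseteq> carrier G" if "k \<in> K" for k using P[OF that] A by blast
      have hQ: "h k <#\<^bsub>G\<^esub> Q (h k) = k <#\<^bsub>G\<^esub> P k" if "k \<in> K" for k
        using that PG g hG by (simp add: Q_def hg lcos_m_assoc)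
      have dis: "disjoint_family_on Q (h ` K)"
        unfolding disjoint_family_on_def
      proof (intro ballI impI)
        fix a b assume ab: "a \<in> h ` K" "b \<in> h ` K" "a \<noteq> b"
        then obtain k l where kl: "k \<in> K" "l \<in> K" "a = h k" "b = h l" by blast
        have "k \<noteq> l" using kl ab by blast
        hence "P k \<inter> P l = {}" using K(3) kl unfolding disjoint_family_on_def by blast
        moreover have "inv\<^bsub>G\<^esub> g <#\<^bsub>G\<^esub> Q a = P k" "inv\<^bsub>G\<^esub> g <#\<^bsub>G\<^esub> Q b = P l"
          using kl PG g by (simp_all add: Q_def hg lcos_m_assoc lcos_mult_one)
        moreover have "inv\<^bsub>G\<^esub> g \<otimes>\<^bsub>G\<^esub> x \<in> (inv\<^bsub>G\<^esub> g <#\<^bsub>G\<^esub> Q a) \<inter> (inv\<^bsub>G\<^esub> g <#\<^bsub>G\<^esub> Q b)"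
          if "x \<in> Q a \<inter> Q b" for x using that by (auto simp: l_coset_def)
        ultimately show "Q a \<inter> Q b = {}" by blast
      qed
      have QA: "Q (h k) \<subseteq> g <#\<^bsub>G\<^esub> A" if "k \<in> K" for k
        using P[OF that] hg[OF that] by (auto simp: Q_def l_coset_def)
      have "(h ` K, Q) \<in> D (g <#\<^bsub>G\<^esub> A)"
        using K hG dis QA hQ P by (auto simp: D_def)
      moreover have "v (h ` K, Q) = v d"
        using inj hQ by (simp add: v_def KP sum.reindex)
      ultimately show "\<exists>d'\<in>D (g <#\<^bsub>G\<^esub> A). ennreal (v d) \<le> ennreal (v d')"
        by (metis order_refl)
    qed
    have "inv\<^bsub>G\<^esub> g <#\<^bsub>G\<^esub> (g <#\<^bsub>G\<^esub> A) = A"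
      using g A by (simp add: lcos_m_assoc lcos_mult_one)
    thus ?thesis
      using le[OF A g] le[of "g <#\<^bsub>G\<^esub> A" "inv\<^bsub>G\<^esub> g"] l_coset_subset_G[OF A g] g by (simp add: antisym)
  qed
  moreover have "\<mu> (A \<union> B) = \<mu> A + \<mu> B"
    if A: "A \<subseteq> carrier G" and B: "B \<subseteq> carrier G" and AB: "A \<inter> B = {}" for A B
  proof (rule antisym)
    show "\<mu> (A \<union> B) \<le> \<mu> A + \<mu> B"
      unfolding \<mu>_def[of "A \<union> B"]
    proof (rule SUP_least)
      fix d assume d: "d \<in> D (A \<union> B)"
      obtain K P where KP: "d = (K, P)" by fastforce
      have K: "finite K" "K \<subseteq> carrier G" "disjoint_family_on P K"
        and P: "\<And>k. k \<in> K \<Longrightarrow> P k \<subseteq> A \<union> B \<and> k <#\<^bsub>G\<^esub> P k \<subseteq> X"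
        using d by (auto simp: D_def KP)
      have sub: "(K, \<lambda>k. P k \<inter> C) \<in> D C" for C
      proof -
        have "disjoint_family_on (\<lambda>k. P k \<inter> C) K"
          using K(3) unfolding disjoint_family_on_def by blast
        moreover have "P k \<inter> C \<subseteq> C \<and> k <#\<^bsub>G\<^esub> (P k \<inter> C) \<subseteq> X" if "k \<in> K" for k
          using P[OF that] unfolding l_coset_def by blast
        ultimately show ?thesis using K by (simp add: D_def)
      qed
      have "m (k <#\<^bsub>G\<^esub> P k) = m (k <#\<^bsub>G\<^esub> (P k \<inter> A)) + m (k <#\<^bsub>G\<^esub> (P k \<inter> B))" if k: "k \<in> K" for k
      proof -
        have eq: "P k = (P k \<inter> A) \<union> (P k \<inter> B)" using P[OF k] by blast
        have "k <#\<^bsub>G\<^esub> (P k \<inter> A) \<subseteq> X" "k <#\<^bsub>G\<^esub> (P k \<inter> B) \<subseteq> X"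
          using P[OF k] by (auto simp: l_coset_def)
        thus ?thesis using k K A B AB by (subst eq, intro lc_add) auto
      qed
      hence "v d = v (K, \<lambda>k. P k \<inter> A) + v (K, \<lambda>k. P k \<inter> B)"
        by (simp add: v_def KP sum.distrib)
      hence "ennreal (v d) = ennreal (v (K, \<lambda>k. P k \<inter> A)) + ennreal (v (K, \<lambda>k. P k \<inter> B))"
        using vpos by simp
      also have "\<dots> \<le> \<mu> A + \<mu> B"
        unfolding \<mu>_def using sub by (intro add_mono SUP_upper)
      finally show "ennreal (v d) \<le> \<mu> A + \<mu> B" .
    qed
    have ne: "D C \<noteq> {}" for C by (auto simp: D_def disjoint_family_on_def intro!: exI[of _ "{}"])
    have "\<exists>d\<in>D (A \<union> B). v a + v b = v d" if ab: "a \<in> D A" "b \<in> D B" for a b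
    proof -
      obtain K P where KP: "a = (K, P)" by fastforce
      obtain L Q where LQ: "b = (L, Q)" by fastforce
      have K: "finite K" "K \<subseteq> carrier G" "disjoint_family_on P K"
        and P: "\<And>k. k \<in> K \<Longrightarrow> P k \<subseteq> A \<and> k <#\<^bsub>G\<^esub> P k \<subseteq> X"
        using ab by (auto simp: D_def KP)
      have L: "finite L" "L \<subseteq> carrier G" "disjoint_family_on Q L"
        and Q: "\<And>k. k \<in> L \<Longrightarrow> Q k \<subseteq> B \<and> k <#\<^bsub>G\<^esub> Q k \<subseteq> X"
        using ab by (auto simp: D_def LQ)
      \<comment> \<open>Extending both families by the empty set lets them be indexed by \<open>K \<union> L\<close>.\<close>
      define P' where "P' k = (if k \<in> K then P k else {})" for k
      define Q' where "Q' k = (if k \<in> L then Q k else {})" for k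
      have lc0: "k <#\<^bsub>G\<^esub> {} = {}" for k by (auto simp: l_coset_def)
      have P': "P' k \<subseteq> A" "k <#\<^bsub>G\<^esub> P' k \<subseteq> X" for k using P by (auto simp: P'_def lc0)
      have Q': "Q' k \<subseteq> B" "k <#\<^bsub>G\<^esub> Q' k \<subseteq> X" for k using Q by (auto simp: Q'_def lc0)
      have "disjoint_family_on (\<lambda>k. P' k \<union> Q' k) (K \<union> L)"
        unfolding disjoint_family_on_def
      proof (intro ballI impI)
        fix k l assume "k \<in> K \<union> L" "l \<in> K \<union> L" "k \<noteq> l"
        hence "P' k \<inter> P' l = {}" "Q' k \<inter> Q' l = {}"
          using K(3) L(3) by (auto simp: P'_def Q'_def disjoint_family_on_def)
        moreover have "P' k \<inter> Q' l = {}" "Q' k \<inter> P' l = {}"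
          using P'(1) Q'(1) AB by blast+
        ultimately show "(P' k \<union> Q' k) \<inter> (P' l \<union> Q' l) = {}" by blast
      qed
      moreover have "P' k \<union> Q' k \<subseteq> A \<union> B" "k <#\<^bsub>G\<^esub> (P' k \<union> Q' k) \<subseteq> X" for k
        using P'[of k] Q'[of k] by (auto simp: lc_Un)
      ultimately have "(K \<union> L, \<lambda>k. P' k \<union> Q' k) \<in> D (A \<union> B)"
        using K(1,2) L(1,2) by (simp add: D_def)
      moreover have "v (K \<union> L, \<lambda>k. P' k \<union> Q' k) = v a + v b"
      proof -
        have "m (k <#\<^bsub>G\<^esub> (P' k \<union> Q' k)) = m (k <#\<^bsub>G\<^esub> P' k) + m (k <#\<^bsub>G\<^esub> Q' k)"
          if "k \<in> K \<union> L" for k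
        proof (rule lc_add)
          show "k \<in> carrier G" using that K L by blast
          show "P' k \<subseteq> carrier G" "Q' k \<subseteq> carrier G" "P' k \<inter> Q' k = {}"
            using P'(1)[of k] Q'(1)[of k] A B AB by auto
        qed (rule P'(2) Q'(2))+
        hence "v (K \<union> L, \<lambda>k. P' k \<union> Q' k) =
            (\<Sum>k\<in>K \<union> L. m (k <#\<^bsub>G\<^esub> P' k)) + (\<Sum>k\<in>K \<union> L. m (k <#\<^bsub>G\<^esub> Q' k))"
          by (simp add: v_def sum.distrib)
        also have "(\<Sum>k\<in>K \<union> L. m (k <#\<^bsub>G\<^esub> P' k)) = (\<Sum>k\<in>K. m (k <#\<^bsub>G\<^esub> P k))"
          using K L by (intro sum.mono_neutral_cong_right) (auto simp: P'_def lc0 empty)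
        also have "(\<Sum>k\<in>K \<union> L. m (k <#\<^bsub>G\<^esub> Q' k)) = (\<Sum>k\<in>L. m (k <#\<^bsub>G\<^esub> Q k))"
          using K L by (intro sum.mono_neutral_cong_right) (auto simp: Q'_def lc0 empty)
        finally show ?thesis by (simp add: v_def KP LQ)
      qed
      ultimately show ?thesis by metis
    qed
    hence "ennreal (v a) + ennreal (v b) \<le> \<mu> (A \<union> B)" if "a \<in> D A" "b \<in> D B" for a b
      using that vpos unfolding \<mu>_def by (metis SUP_upper ennreal_plus)
    hence "(SUP b\<in>D B. SUP a\<in>D A. ennreal (v a) + ennreal (v b)) \<le> \<mu> (A \<union> B)"
      by (intro SUP_least)
    thus "\<mu> A + \<mu> B \<le> \<mu> (A \<union> B)"
      unfolding \<mu>_def[of A] \<mu>_def[of B]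
      by (simp add: ennreal_SUP_add_right[OF ne] ennreal_SUP_add_left[OF ne, symmetric])
  qed
  ultimately show ?thesis unfolding amenable_subset_def by blast
qed

lemma not_amenable_imp_compresses:
  assumes "group G" "X \<subseteq> carrier G" "\<not> amenable_subset G X"
  shows "\<exists>n. compresses G X n"
  using ex_invariant_mean[OF assms(1,2)] invariant_mean_extends[OF assms(1,2)] assms(3) by blast

section \<open>Epimorphisms of free modules and matrices\<close>

lemma (in abelian_monoid) finsum_swap:
  assumes "finite I" "finite J" "\<And>i j. i \<in> I \<Longrightarrow> j \<in> J \<Longrightarrow> f i j \<in> carrier G"
  shows "(\<Oplus>i\<in>I. \<Oplus>j\<in>J. f i j) = (\<Oplus>j\<in>J. \<Oplus>i\<in>I. f i j)"
  using assms(1,3)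
proof (induction I)
  case empty
  thus ?case by simp
next
  case (insert i I)
  have c: "f i \<in> J \<rightarrow> carrier G" "(\<lambda>j. \<Oplus>i\<in>I. f i j) \<in> J \<rightarrow> carrier G"
    using insert.prems by (auto intro!: finsum_closed)
  have "(\<Oplus>i\<in>insert i I. \<Oplus>j\<in>J. f i j) = (\<Oplus>j\<in>J. f i j) \<oplus> (\<Oplus>i\<in>I. \<Oplus>j\<in>J. f i j)"
    using insert by (intro finsum_insert) (auto intro!: finsum_closed)
  also have "\<dots> = (\<Oplus>j\<in>J. f i j) \<oplus> (\<Oplus>j\<in>J. \<Oplus>i\<in>I. f i j)"
    using insert by simp
  also have "\<dots> = (\<Oplus>j\<in>J. f i j \<oplus> (\<Oplus>i\<in>I. f i j))"
    using finsum_addf[OF c] by simp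
  also have "\<dots> = (\<Oplus>j\<in>J. \<Oplus>i\<in>insert i I. f i j)"
    using insert by (intro finsum_cong' refl) (auto intro!: finsum_closed finsum_insert[symmetric])
  finally show ?case .
qed

lemma (in abelian_monoid) finsum_cartesian_product:
  assumes "finite I" "finite J" "\<And>i j. i \<in> I \<Longrightarrow> j \<in> J \<Longrightarrow> f (i, j) \<in> carrier G"
  shows "(\<Oplus>p\<in>I \<times> J. f p) = (\<Oplus>i\<in>I. \<Oplus>j\<in>J. f (i, j))"
  using assms(1,3)
proof (induction I)
  case (insert i I)
  have "insert i I \<times> J = Pair i ` J \<union> I \<times> J" by auto
  hence "(\<Oplus>p\<in>insert i I \<times> J. f p) = (\<Oplus>p\<in>Pair i ` J. f p) \<oplus> (\<Oplus>p\<in>I \<times> J. f p)"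
    using insert assms(2) by (simp only:) (intro finsum_Un_disjoint, auto)
  also have "(\<Oplus>p\<in>Pair i ` J. f p) = (\<Oplus>j\<in>J. f (i, j))"
    using insert by (intro finsum_reindex) (auto simp: inj_on_def)
  also have "(\<Oplus>p\<in>I \<times> J. f p) = (\<Oplus>i\<in>I. \<Oplus>j\<in>J. f (i, j))" using insert by simp
  also have "(\<Oplus>j\<in>J. f (i, j)) \<oplus> \<dots> = (\<Oplus>i\<in>insert i I. \<Oplus>j\<in>J. f (i, j))"
    using insert by (intro finsum_insert[symmetric]) (auto intro!: finsum_closed)
  finally show ?case .
qed simp

lemma (in semiring) finsum_delta:
  assumes "finite J" "i \<in> J" "w \<in> J \<rightarrow> carrier R"
  shows "(\<Oplus>k\<in>J. (if i = k then \<one> else \<zero>) \<otimes> w k) = w i"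
proof -
  have "(\<Oplus>k\<in>J. (if i = k then \<one> else \<zero>) \<otimes> w k) = (\<Oplus>k\<in>J. if i = k then w k else \<zero>)"
    using assms by (intro finsum_cong' refl) (auto simp: Pi_iff)
  also have "\<dots> = w i" using assms by (intro finsum_singleton) auto
  finally show ?thesis .
qed

text \<open>There are an \<open>I \<times> J\<close> matrix \<open>A\<close> and a \<open>J \<times> I\<close> matrix \<open>B\<close> over \<open>S\<close> with \<open>A B = 1\<close>. For finite
  \<open>I\<close> and \<open>J\<close> over a ring this says that \<open>S\<^sup>I\<close> is a retract of \<open>S\<^sup>J\<close>. The predicate is only used
  for finite \<open>J\<close>, where the sum is meaningful.\<close>

definition matrix_retract :: "('s, 'm) ring_scheme \<Rightarrow> 'i set \<Rightarrow> 'j set \<Rightarrow> bool" where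
  "matrix_retract S I J \<longleftrightarrow> (\<exists>A B. (\<forall>i\<in>I. \<forall>j\<in>J. A i j \<in> carrier S \<and> B j i \<in> carrier S) \<and>
     (\<forall>i\<in>I. \<forall>k\<in>I. (\<Oplus>\<^bsub>S\<^esub>j\<in>J. A i j \<otimes>\<^bsub>S\<^esub> B j k) = (if i = k then \<one>\<^bsub>S\<^esub> else \<zero>\<^bsub>S\<^esub>)))"

lemma (in ring) retract_reindex:
  assumes "matrix_retract R I J" "inj_on \<phi> I'" "\<phi> ` I' \<subseteq> I" "bij_betw \<psi> J' J"
  shows "matrix_retract R I' J'"
proof -
  obtain A B where c: "\<And>i j. i \<in> I \<Longrightarrow> j \<in> J \<Longrightarrow> A i j \<in> carrier R \<and> B j i \<in> carrier R"
    and AB: "\<And>i k. i \<in> I \<Longrightarrow> k \<in> I \<Longrightarrow> (\<Oplus>j\<in>J. A i j \<otimes> B j k) = (if i = k then \<one> else \<zero>)"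
    using assms(1) unfolding matrix_retract_def by blast
  have \<psi>: "\<psi> ` J' = J" "inj_on \<psi> J'" using assms(4) by (auto simp: bij_betw_def)
  have "(\<Oplus>j\<in>J'. A (\<phi> i) (\<psi> j) \<otimes> B (\<psi> j) (\<phi> k)) = (if i = k then \<one> else \<zero>)"
    if ik: "i \<in> I'" "k \<in> I'" for i k
  proof -
    have "(\<Oplus>j\<in>J'. A (\<phi> i) (\<psi> j) \<otimes> B (\<psi> j) (\<phi> k)) = (\<Oplus>j\<in>\<psi> ` J'. A (\<phi> i) j \<otimes> B j (\<phi> k))"
    proof (intro finsum_reindex[symmetric])
      have "\<phi> i \<in> I" "\<phi> k \<in> I" using ik assms(3) by auto
      thus "(\<lambda>j. A (\<phi> i) j \<otimes> B j (\<phi> k)) \<in> \<psi> ` J' \<rightarrow> carrier R" using c \<psi>(1) by auto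
    qed (rule \<psi>)
    also have "\<dots> = (if \<phi> i = \<phi> k then \<one> else \<zero>)" unfolding \<psi> using ik assms(3) by (intro AB) auto
    also have "\<phi> i = \<phi> k \<longleftrightarrow> i = k" using assms(2) ik by (auto dest: inj_onD)
    finally show ?thesis .
  qed
  moreover have "A (\<phi> i) (\<psi> j) \<in> carrier R \<and> B (\<psi> j) (\<phi> i) \<in> carrier R" if "i \<in> I'" "j \<in> J'" for i j
    using that c assms(3) \<psi> by blast
  ultimately show ?thesis unfolding matrix_retract_def
    by (intro exI[of _ "\<lambda>i j. A (\<phi> i) (\<psi> j)"] exI[of _ "\<lambda>j i. B (\<psi> j) (\<phi> i)"]) blast
qed

lemma retract_ring_hom:
  assumes "ring R" "ring S" "h \<in> ring_hom R S" "matrix_retract R I J"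
  shows "matrix_retract S I J"
proof -
  interpret h: ring_hom_ring R S h using assms by (intro ring_hom_ringI2)
  obtain A B where c: "\<And>i j. i \<in> I \<Longrightarrow> j \<in> J \<Longrightarrow> A i j \<in> carrier R \<and> B j i \<in> carrier R"
    and AB: "\<And>i k. i \<in> I \<Longrightarrow> k \<in> I \<Longrightarrow>
      (\<Oplus>\<^bsub>R\<^esub>j\<in>J. A i j \<otimes>\<^bsub>R\<^esub> B j k) = (if i = k then \<one>\<^bsub>R\<^esub> else \<zero>\<^bsub>R\<^esub>)"
    using assms(4) unfolding matrix_retract_def by blast
  have "(\<Oplus>\<^bsub>S\<^esub>j\<in>J. h (A i j) \<otimes>\<^bsub>S\<^esub> h (B j k)) = (if i = k then \<one>\<^bsub>S\<^esub> else \<zero>\<^bsub>S\<^esub>)"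
    if ik: "i \<in> I" "k \<in> I" for i k
  proof -
    have "(\<Oplus>\<^bsub>S\<^esub>j\<in>J. h (A i j) \<otimes>\<^bsub>S\<^esub> h (B j k)) = (\<Oplus>\<^bsub>S\<^esub>j\<in>J. h (A i j \<otimes>\<^bsub>R\<^esub> B j k))"
      using c ik by (intro h.S.finsum_cong' refl) auto
    also have "\<dots> = h (\<Oplus>\<^bsub>R\<^esub>j\<in>J. A i j \<otimes>\<^bsub>R\<^esub> B j k)"
      using c ik by (subst h.hom_finsum) (auto simp: comp_def)
    finally show ?thesis using AB[OF ik] by simp
  qed
  thus ?thesis unfolding matrix_retract_def using c
    by (intro exI[of _ "\<lambda>i j. h (A i j)"] exI[of _ "\<lambda>j i. h (B j i)"]) auto
qed

lemma (in ring) retract_imp_epi: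
  assumes "matrix_retract R {..<m} {..<n}"
  shows "\<exists>f\<in>free_rmod_hom R n m. f ` free_rmod R n = free_rmod R m"
proof -
  obtain A B where c: "\<And>i j. i < m \<Longrightarrow> j < n \<Longrightarrow> A i j \<in> carrier R \<and> B j i \<in> carrier R"
    and AB: "\<And>i k. i < m \<Longrightarrow> k < m \<Longrightarrow> (\<Oplus>j\<in>{..<n}. A i j \<otimes> B j k) = (if i = k then \<one> else \<zero>)"
    using assms unfolding matrix_retract_def Ball_def lessThan_iff by blast
  define f where "f v = (\<lambda>i\<in>{..<m}. \<Oplus>j\<in>{..<n}. A i j \<otimes> v j)" for v
  have Pi: "f v \<in> free_rmod R m" if "v \<in> free_rmod R n" for v
  proof -
    have "v j \<in> carrier R" if "j < n" for j using \<open>v \<in> _\<close> that by (auto simp: free_rmod_def)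
    thus ?thesis using c unfolding f_def free_rmod_def by (intro restrict_PiE_iff[THEN iffD2] ballI finsum_closed) auto
  qed
  have "f (free_rmod_add R n u v) = free_rmod_add R m (f u) (f v)"
    if "u \<in> free_rmod R n" "v \<in> free_rmod R n" for u v
  proof
    fix i
    have uv: "u j \<in> carrier R" "v j \<in> carrier R" if "j < n" for j
      using \<open>u \<in> _\<close> \<open>v \<in> _\<close> that by (auto simp: free_rmod_def)
    show "f (free_rmod_add R n u v) i = free_rmod_add R m (f u) (f v) i"
    proof (cases "i < m")
      case True
      have "(\<Oplus>j\<in>{..<n}. A i j \<otimes> free_rmod_add R n u v j) = (\<Oplus>j\<in>{..<n}. A i j \<otimes> u j \<oplus> A i j \<otimes> v j)"
        using c[OF True] uv by (intro finsum_cong' refl) (auto simp: free_rmod_add_def r_distr)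
      also have "\<dots> = (\<Oplus>j\<in>{..<n}. A i j \<otimes> u j) \<oplus> (\<Oplus>j\<in>{..<n}. A i j \<otimes> v j)"
        using c[OF True] uv by (intro finsum_addf) auto
      finally show ?thesis using True by (simp add: f_def free_rmod_add_def)
    qed (simp add: f_def free_rmod_add_def)
  qed
  moreover have "f (free_rmod_smult R n v s) = free_rmod_smult R m (f v) s"
    if "v \<in> free_rmod R n" and s: "s \<in> carrier R" for v s
  proof
    fix i
    have v: "v j \<in> carrier R" if "j < n" for j
      using \<open>v \<in> _\<close> that by (auto simp: free_rmod_def)
    show "f (free_rmod_smult R n v s) i = free_rmod_smult R m (f v) s i"
    proof (cases "i < m")
      case True
      have "(\<Oplus>j\<in>{..<n}. A i j \<otimes> free_rmod_smult R n v s j) = (\<Oplus>j\<in>{..<n}. (A i j \<otimes> v j) \<otimes> s)"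
        using c[OF True] v s by (intro finsum_cong' refl) (auto simp: free_rmod_smult_def m_assoc)
      also have "\<dots> = (\<Oplus>j\<in>{..<n}. A i j \<otimes> v j) \<otimes> s"
        using c[OF True] v s by (intro finsum_ldistr[symmetric]) auto
      finally show ?thesis using True by (simp add: f_def free_rmod_smult_def)
    qed (simp add: f_def free_rmod_smult_def)
  qed
  ultimately have "f \<in> free_rmod_hom R n m" using Pi by (simp add: free_rmod_hom_def)
  moreover have "w \<in> f ` free_rmod R n" if "w \<in> free_rmod R m" for w
  proof
    have w: "w k \<in> carrier R" if "k < m" for k using \<open>w \<in> _\<close> that by (auto simp: free_rmod_def)
    define v where "v = (\<lambda>j\<in>{..<n}. \<Oplus>k\<in>{..<m}. B j k \<otimes> w k)"
    show "v \<in> free_rmod R n" using c w unfolding v_def free_rmod_def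
      by (intro restrict_PiE_iff[THEN iffD2] ballI finsum_closed) auto
    show "w = f v"
    proof
      fix i
      show "w i = f v i"
      proof (cases "i < m")
        case True
        have "(\<Oplus>j\<in>{..<n}. A i j \<otimes> v j) = (\<Oplus>j\<in>{..<n}. \<Oplus>k\<in>{..<m}. A i j \<otimes> B j k \<otimes> w k)"
        proof (intro finsum_cong' refl)
          fix j assume j: "j \<in> {..<n}"
          have "A i j \<otimes> v j = (\<Oplus>k\<in>{..<m}. A i j \<otimes> (B j k \<otimes> w k))"
            using c True w j by (simp add: v_def finsum_rdistr Pi_iff)
          also have "\<dots> = (\<Oplus>k\<in>{..<m}. A i j \<otimes> B j k \<otimes> w k)"
            using c True w j by (intro finsum_cong' refl) (auto simp: m_assoc)
          finally show "A i j \<otimes> v j = (\<Oplus>k\<in>{..<m}. A i j \<otimes> B j k \<otimes> w k)" .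
        next
          show "(\<lambda>j. \<Oplus>k\<in>{..<m}. A i j \<otimes> B j k \<otimes> w k) \<in> {..<n} \<rightarrow> carrier R"
            using c True w by (intro Pi_I finsum_closed) auto
        qed
        also have "\<dots> = (\<Oplus>k\<in>{..<m}. \<Oplus>j\<in>{..<n}. A i j \<otimes> B j k \<otimes> w k)"
          using c True w by (intro finsum_swap) auto
        also have "\<dots> = (\<Oplus>k\<in>{..<m}. (if i = k then \<one> else \<zero>) \<otimes> w k)"
        proof (intro finsum_cong' refl)
          fix k assume k: "k \<in> {..<m}"
          have "(\<Oplus>j\<in>{..<n}. A i j \<otimes> B j k \<otimes> w k) = (\<Oplus>j\<in>{..<n}. A i j \<otimes> B j k) \<otimes> w k"
            using c True w k by (intro finsum_ldistr[symmetric]) auto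
          thus "(\<Oplus>j\<in>{..<n}. A i j \<otimes> B j k \<otimes> w k) = (if i = k then \<one> else \<zero>) \<otimes> w k"
            using AB True k by simp
        qed (use w in auto)
        also have "\<dots> = w i" using True w by (intro finsum_delta) auto
        finally show ?thesis using True by (simp add: f_def)
      next
        case False
        thus ?thesis using \<open>w \<in> _\<close> by (auto simp: f_def free_rmod_def PiE_iff extensional_def)
      qed
    qed
  qed
  ultimately show ?thesis using Pi by blast
qed

text \<open>A homomorphism is multiplication by the matrix whose columns are the images of the standard
  basis vectors.\<close>

lemma (in ring) free_rmod_hom_matrix:
  assumes f: "f \<in> free_rmod_hom R n m" and v: "v \<in> free_rmod R n" and i: "i < m"
  shows "f v i = (\<Oplus>j\<in>{..<n}. f (\<lambda>l\<in>{..<n}. if l = j then \<one> else \<zero>) i \<otimes> v j)"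
proof -
  have fPi: "\<And>u. u \<in> free_rmod R n \<Longrightarrow> f u \<in> free_rmod R m"
    and fadd: "\<And>u v. u \<in> free_rmod R n \<Longrightarrow> v \<in> free_rmod R n \<Longrightarrow>
      f (free_rmod_add R n u v) = free_rmod_add R m (f u) (f v)"
    and fsm: "\<And>v s. v \<in> free_rmod R n \<Longrightarrow> s \<in> carrier R \<Longrightarrow>
      f (free_rmod_smult R n v s) = free_rmod_smult R m (f v) s"
    using f by (auto simp: free_rmod_hom_def)
  define e where "e j = (\<lambda>l\<in>{..<n}. if l = j then \<one> else \<zero>)" for j
  have e: "e j \<in> free_rmod R n" for j by (auto simp: e_def free_rmod_def)
  have fi: "f u i \<in> carrier R" if "u \<in> free_rmod R n" for u
    using fPi[OF that] i by (auto simp: free_rmod_def)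
  have vc: "v j \<in> carrier R" if "j < n" for j using v that by (auto simp: free_rmod_def)
  \<comment> \<open>Induction over the truncations of \<open>v\<close> to its first \<open>k\<close> coordinates.\<close>
  define t where "t k = (\<lambda>l\<in>{..<n}. if l < k then v l else \<zero>)" for k
  have t: "t k \<in> free_rmod R n" for k using vc by (auto simp: t_def free_rmod_def)
  have "f (t k) i = (\<Oplus>j\<in>{..<k}. f (e j) i \<otimes> v j)" if "k \<le> n" for k
    using that
  proof (induction k)
    case 0
    have "t 0 = free_rmod_smult R n (t 0) \<zero>" by (auto simp: t_def free_rmod_smult_def)
    hence "f (t 0) i = free_rmod_smult R m (f (t 0)) \<zero> i" using fsm[OF t, of \<zero> 0] by simp
    also have "\<dots> = \<zero>" using fi[OF t] i by (simp add: free_rmod_smult_def)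
    finally show ?case by simp
  next
    case (Suc k)
    have vk: "v k \<in> carrier R" using Suc vc by auto
    have s: "free_rmod_smult R n (e k) (v k) \<in> free_rmod R n"
      using vk by (auto simp: e_def free_rmod_def free_rmod_smult_def)
    have "t (Suc k) = free_rmod_add R n (t k) (free_rmod_smult R n (e k) (v k))"
      using vc vk by (auto simp: t_def e_def free_rmod_smult_def free_rmod_add_def fun_eq_iff less_Suc_eq)
    hence "f (t (Suc k)) i = f (t k) i \<oplus> f (e k) i \<otimes> v k"
      using fadd[OF t s, of k] fsm[OF e vk, of k] i by (simp add: free_rmod_add_def free_rmod_smult_def)
    also have "\<dots> = f (e k) i \<otimes> v k \<oplus> f (t k) i"
      by (intro a_comm m_closed fi t e vk)
    also have "f (t k) i = (\<Oplus>j\<in>{..<k}. f (e j) i \<otimes> v j)" using Suc by simp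
    also have "f (e k) i \<otimes> v k \<oplus> \<dots> = (\<Oplus>j\<in>insert k {..<k}. f (e j) i \<otimes> v j)"
      using Suc fi e vc by (intro finsum_insert[symmetric]) auto
    finally show ?case by (simp add: lessThan_Suc)
  qed
  from this[of n] have "f (t n) i = (\<Oplus>j\<in>{..<n}. f (e j) i \<otimes> v j)" by simp
  moreover have "t n = v" using v by (auto simp: t_def free_rmod_def PiE_iff extensional_def fun_eq_iff)
  ultimately show ?thesis by (simp add: e_def)
qed

lemma (in ring) epi_imp_retract:
  assumes f: "f \<in> free_rmod_hom R n m" and surj: "f ` free_rmod R n = free_rmod R m"
  shows "matrix_retract R {..<m} {..<n}"
proof -
  define e where "e k j = (\<lambda>l\<in>{..<k}. if l = j then \<one> else \<zero>)" for k j :: nat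
  have e: "e k j \<in> free_rmod R k" for j k by (auto simp: e_def free_rmod_def)
  have "\<exists>v. v \<in> free_rmod R n \<and> f v = e m k" for k
  proof -
    have "e m k \<in> f ` free_rmod R n" using e[of m k] by (simp only: surj)
    then obtain v where "e m k = f v" "v \<in> free_rmod R n" by (rule imageE)
    thus ?thesis by (intro exI[of _ v] conjI) simp_all
  qed
  then obtain b where b: "\<And>k. b k \<in> free_rmod R n" and fb: "\<And>k. f (b k) = e m k" by metis
  let ?A = "\<lambda>i j. f (e n j) i"
  have "?A i j \<in> carrier R" if "i < m" for i j
  proof -
    have "f (e n j) \<in> free_rmod R m" unfolding surj[symmetric] by (rule imageI[OF e])
    thus ?thesis using that by (auto simp: free_rmod_def)
  qed
  moreover have "b k j \<in> carrier R" if "j < n" for k j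
    using b[of k] that by (auto simp: free_rmod_def)
  moreover have "(\<Oplus>j\<in>{..<n}. ?A i j \<otimes> b k j) = (if i = k then \<one> else \<zero>)" if "i < m" for i k
    using free_rmod_hom_matrix[OF f b that, of k] fb[of k] that by (simp add: e_def)
  ultimately show ?thesis unfolding matrix_retract_def
    by (intro exI[of _ ?A] exI[of _ "\<lambda>j k. b k j"]) auto
qed

lemma (in ring) UGN_iff:
  "UGN R \<longleftrightarrow> (\<forall>n :: nat. n > 0 \<longrightarrow> \<not> matrix_retract R {..<n + 1} {..<n})"
proof -
  have "(\<exists>f\<in>free_rmod_hom R n (n + 1). f ` free_rmod R n = free_rmod R (n + 1)) \<longleftrightarrow>
      matrix_retract R {..<n + 1} {..<n}" for n
    using retract_imp_epi[of "n + 1" n] epi_imp_retract[of _ n "n + 1"] by auto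
  thus ?thesis by (simp add: UGN_def)
qed

text \<open>\<open>J\<close> must be nonempty: the definition of UGN only considers modules of positive rank.\<close>

lemma (in ring) retract_imp_not_UGN:
  assumes "matrix_retract R I J" "finite I" "finite J" "J \<noteq> {}" "card J < card I"
  shows "\<not> UGN R"
proof -
  obtain \<phi> where \<phi>: "bij_betw \<phi> {..<card I} I"
    using ex_bij_betw_nat_finite[OF assms(2)] by (auto simp: atLeast0LessThan)
  obtain \<psi> where \<psi>: "bij_betw \<psi> {..<card J} J"
    using ex_bij_betw_nat_finite[OF assms(3)] by (auto simp: atLeast0LessThan)
  have sub: "{..<card J + 1} \<subseteq> {..<card I}" using assms(5) by auto
  have "matrix_retract R {..<card J + 1} {..<card J}"
  proof (rule retract_reindex[OF assms(1) _ _ \<psi>])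
    show "inj_on \<phi> {..<card J + 1}" using \<phi> sub by (auto simp: bij_betw_def intro: inj_on_subset)
    show "\<phi> ` {..<card J + 1} \<subseteq> I" using \<phi> sub by (auto simp: bij_betw_def)
  qed
  moreover have "card J > 0" using assms by (simp add: card_gt_0_iff)
  ultimately show ?thesis unfolding UGN_iff by (intro notI) auto
qed

section \<open>The translation ring\<close>

text \<open>The data of a translation ring \<open>T\<close>. The set \<open>X\<close> may be empty here.\<close>

locale translation = G: group G + R: ring R
  for G :: "('g, 'm) monoid_scheme" and R :: "('r, 'k) ring_scheme" +
  fixes X :: "'g set"
  assumes X_subset: "X \<subseteq> carrier G"
begin

abbreviation T where "T \<equiv> translation_ring G X R"

lemma carrier_memI:
  assumes "\<And>x y. x \<in> X \<Longrightarrow> y \<in> X \<Longrightarrow> c x y \<in> carrier R" "finite K" "K \<subseteq> carrier G"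
    and "\<And>x y. x \<in> X \<Longrightarrow> y \<in> X \<Longrightarrow> c x y \<noteq> \<zero>\<^bsub>R\<^esub> \<Longrightarrow> y \<in> K #>\<^bsub>G\<^esub> x"
  shows "(\<lambda>(x, y)\<in>X \<times> X. c x y) \<in> carrier T"
  unfolding translation_ring_def using assms by (auto intro!: exI[of _ K]) (metis assms(4))

lemma entry_closed: "M \<in> carrier T \<Longrightarrow> x \<in> X \<Longrightarrow> y \<in> X \<Longrightarrow> M (x, y) \<in> carrier R"
  by (auto simp: translation_ring_def)

lemma bandE:
  assumes "M \<in> carrier T"
  obtains K where "finite K" "K \<subseteq> carrier G"
    "\<And>x y. x \<in> X \<Longrightarrow> y \<in> X \<Longrightarrow> M (x, y) \<noteq> \<zero>\<^bsub>R\<^esub> \<Longrightarrow> y \<in> K #>\<^bsub>G\<^esub> x"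
proof -
  obtain K where "finite K" "K \<subseteq> carrier G"
    "\<forall>x\<in>X. \<forall>y\<in>X. y \<notin> K #>\<^bsub>G\<^esub> x \<longrightarrow> M (x, y) = \<zero>\<^bsub>R\<^esub>"
    using assms by (auto simp: translation_ring_def)
  thus thesis using that[of K] by blast
qed

lemma entry_eqI:
  assumes "M \<in> carrier T" "N \<in> carrier T" "\<And>x y. x \<in> X \<Longrightarrow> y \<in> X \<Longrightarrow> M (x, y) = N (x, y)"
  shows "M = N"
proof (rule PiE_ext)
  show "M \<in> X \<times> X \<rightarrow>\<^sub>E carrier R" "N \<in> X \<times> X \<rightarrow>\<^sub>E carrier R"
    using assms by (auto simp: translation_ring_def)
qed (use assms(3) in auto)

lemma finite_row:
  assumes "M \<in> carrier T" "x \<in> X"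
  shows "finite {z \<in> X. M (x, z) \<noteq> \<zero>\<^bsub>R\<^esub>}"
proof -
  obtain K where K: "finite K" "\<And>y. y \<in> X \<Longrightarrow> M (x, y) \<noteq> \<zero>\<^bsub>R\<^esub> \<Longrightarrow> y \<in> K #>\<^bsub>G\<^esub> x"
    using bandE[OF assms(1)] assms(2) by metis
  have "{z \<in> X. M (x, z) \<noteq> \<zero>\<^bsub>R\<^esub>} \<subseteq> K #>\<^bsub>G\<^esub> x" using K(2) by blast
  moreover have "finite (K #>\<^bsub>G\<^esub> x)" using K(1) by (simp add: r_coset_def)
  ultimately show ?thesis by (rule finite_subset)
qed

lemma add_entry: "x \<in> X \<Longrightarrow> y \<in> X \<Longrightarrow> (M \<oplus>\<^bsub>T\<^esub> N) (x, y) = M (x, y) \<oplus>\<^bsub>R\<^esub> N (x, y)"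
  by (simp add: translation_ring_def)

lemma zero_entry: "x \<in> X \<Longrightarrow> y \<in> X \<Longrightarrow> \<zero>\<^bsub>T\<^esub> (x, y) = \<zero>\<^bsub>R\<^esub>"
  by (simp add: translation_ring_def)

lemma one_entry: "x \<in> X \<Longrightarrow> y \<in> X \<Longrightarrow> \<one>\<^bsub>T\<^esub> (x, y) = (if x = y then \<one>\<^bsub>R\<^esub> else \<zero>\<^bsub>R\<^esub>)"
  by (simp add: translation_ring_def)

text \<open>An entry of a product may be computed as a sum over any finite set that contains the support
  of the row of the left factor; this makes different products comparable.\<close>

lemma mult_entry:
  assumes M: "M \<in> carrier T" and N: "N \<in> carrier T" and xy: "x \<in> X" "y \<in> X"
    and Z: "finite Z" "Z \<subseteq> X" "\<And>z. z \<in> X \<Longrightarrow> M (x, z) \<noteq> \<zero>\<^bsub>R\<^esub> \<Longrightarrow> z \<in> Z"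
  shows "(M \<otimes>\<^bsub>T\<^esub> N) (x, y) = (\<Oplus>\<^bsub>R\<^esub>z\<in>Z. M (x, z) \<otimes>\<^bsub>R\<^esub> N (z, y))"
proof -
  let ?S = "{z \<in> X. M (x, z) \<otimes>\<^bsub>R\<^esub> N (z, y) \<noteq> \<zero>\<^bsub>R\<^esub>}"
  have S: "?S \<subseteq> Z"
  proof
    fix z assume z: "z \<in> ?S"
    hence "N (z, y) \<in> carrier R" using N xy by (simp add: entry_closed)
    hence "M (x, z) \<noteq> \<zero>\<^bsub>R\<^esub>" using z by auto
    thus "z \<in> Z" using Z(3) z by simp
  qed
  have "(\<Oplus>\<^bsub>R\<^esub>z\<in>?S. M (x, z) \<otimes>\<^bsub>R\<^esub> N (z, y)) = (\<Oplus>\<^bsub>R\<^esub>z\<in>Z. M (x, z) \<otimes>\<^bsub>R\<^esub> N (z, y))"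
    using Z(1,2) S M N xy entry_closed
    by (intro R.add.finprod_mono_neutral_cong_left) auto
  thus ?thesis using xy by (simp add: translation_ring_def)
qed

lemma add_closed:
  assumes M: "M \<in> carrier T" and N: "N \<in> carrier T"
  shows "M \<oplus>\<^bsub>T\<^esub> N \<in> carrier T"
proof -
  obtain K where K: "finite K" "K \<subseteq> carrier G"
    "\<And>x y. x \<in> X \<Longrightarrow> y \<in> X \<Longrightarrow> M (x, y) \<noteq> \<zero>\<^bsub>R\<^esub> \<Longrightarrow> y \<in> K #>\<^bsub>G\<^esub> x" using bandE[OF M] by metis
  obtain L where L: "finite L" "L \<subseteq> carrier G"
    "\<And>x y. x \<in> X \<Longrightarrow> y \<in> X \<Longrightarrow> N (x, y) \<noteq> \<zero>\<^bsub>R\<^esub> \<Longrightarrow> y \<in> L #>\<^bsub>G\<^esub> x" using bandE[OF N] by metis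
  have "(\<lambda>(x, y)\<in>X \<times> X. M (x, y) \<oplus>\<^bsub>R\<^esub> N (x, y)) \<in> carrier T"
  proof (rule carrier_memI[where K = "K \<union> L"])
    fix x y assume xy: "x \<in> X" "y \<in> X" "M (x, y) \<oplus>\<^bsub>R\<^esub> N (x, y) \<noteq> \<zero>\<^bsub>R\<^esub>"
    hence "M (x, y) \<noteq> \<zero>\<^bsub>R\<^esub> \<or> N (x, y) \<noteq> \<zero>\<^bsub>R\<^esub>" by auto
    thus "y \<in> (K \<union> L) #>\<^bsub>G\<^esub> x" using K(3)[OF xy(1,2)] L(3)[OF xy(1,2)] by (auto simp: r_coset_def)
  qed (use K L M N entry_closed in auto)
  thus ?thesis by (simp add: translation_ring_def)
qed

lemma uminus_closed:
  assumes M: "M \<in> carrier T"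
  shows "(\<lambda>(x, y)\<in>X \<times> X. \<ominus>\<^bsub>R\<^esub> M (x, y)) \<in> carrier T"
proof -
  obtain K where K: "finite K" "K \<subseteq> carrier G"
    "\<And>x y. x \<in> X \<Longrightarrow> y \<in> X \<Longrightarrow> M (x, y) \<noteq> \<zero>\<^bsub>R\<^esub> \<Longrightarrow> y \<in> K #>\<^bsub>G\<^esub> x" using bandE[OF M] by metis
  show ?thesis
    by (rule carrier_memI[where K = K]) (use K M entry_closed in auto)
qed

lemma zero_closed: "\<zero>\<^bsub>T\<^esub> \<in> carrier T"
  using carrier_memI[of "\<lambda>_ _. \<zero>\<^bsub>R\<^esub>" "{}"] by (simp add: translation_ring_def)

lemma diag_closed:
  assumes "r \<in> carrier R"
  shows "(\<lambda>(x, y)\<in>X \<times> X. if x = y then r else \<zero>\<^bsub>R\<^esub>) \<in> carrier T"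
proof (rule carrier_memI[where K = "{\<one>\<^bsub>G\<^esub>}"])
  fix x y assume "x \<in> X" "(if x = y then r else \<zero>\<^bsub>R\<^esub>) \<noteq> \<zero>\<^bsub>R\<^esub>"
  thus "y \<in> {\<one>\<^bsub>G\<^esub>} #>\<^bsub>G\<^esub> x" using X_subset by (auto simp: r_coset_def split: if_splits)
qed (use assms in auto)

lemma one_closed: "\<one>\<^bsub>T\<^esub> \<in> carrier T"
  using diag_closed[of "\<one>\<^bsub>R\<^esub>"] by (simp add: translation_ring_def)

lemma mult_closed:
  assumes M: "M \<in> carrier T" and N: "N \<in> carrier T"
  shows "M \<otimes>\<^bsub>T\<^esub> N \<in> carrier T"
proof -
  obtain K where K: "finite K" "K \<subseteq> carrier G"
    "\<And>x y. x \<in> X \<Longrightarrow> y \<in> X \<Longrightarrow> M (x, y) \<noteq> \<zero>\<^bsub>R\<^esub> \<Longrightarrow> y \<in> K #>\<^bsub>G\<^esub> x" using bandE[OF M] by metis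
  obtain L where L: "finite L" "L \<subseteq> carrier G"
    "\<And>x y. x \<in> X \<Longrightarrow> y \<in> X \<Longrightarrow> N (x, y) \<noteq> \<zero>\<^bsub>R\<^esub> \<Longrightarrow> y \<in> L #>\<^bsub>G\<^esub> x" using bandE[OF N] by metis
  let ?S = "\<lambda>x y. {z \<in> X. M (x, z) \<otimes>\<^bsub>R\<^esub> N (z, y) \<noteq> \<zero>\<^bsub>R\<^esub>}"
  have "(\<lambda>(x, y)\<in>X \<times> X. \<Oplus>\<^bsub>R\<^esub>z\<in>?S x y. M (x, z) \<otimes>\<^bsub>R\<^esub> N (z, y)) \<in> carrier T"
  proof (rule carrier_memI)
    show "finite (L <#>\<^bsub>G\<^esub> K)" using K(1) L(1) by (simp add: set_mult_def)
    show "L <#>\<^bsub>G\<^esub> K \<subseteq> carrier G" using K(2) L(2) by (auto simp: set_mult_def)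
    fix x y assume xy: "x \<in> X" "y \<in> X"
    show "(\<Oplus>\<^bsub>R\<^esub>z\<in>?S x y. M (x, z) \<otimes>\<^bsub>R\<^esub> N (z, y)) \<in> carrier R"
      using M N xy entry_closed by (intro R.finsum_closed) auto
    assume "(\<Oplus>\<^bsub>R\<^esub>z\<in>?S x y. M (x, z) \<otimes>\<^bsub>R\<^esub> N (z, y)) \<noteq> \<zero>\<^bsub>R\<^esub>"
    hence "?S x y \<noteq> {}" by (metis R.finsum_empty)
    then obtain z where z: "z \<in> X" "M (x, z) \<otimes>\<^bsub>R\<^esub> N (z, y) \<noteq> \<zero>\<^bsub>R\<^esub>" by blast
    have "M (x, z) \<noteq> \<zero>\<^bsub>R\<^esub>" "N (z, y) \<noteq> \<zero>\<^bsub>R\<^esub>"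
      using z xy M N entry_closed by auto
    hence "z \<in> K #>\<^bsub>G\<^esub> x" "y \<in> L #>\<^bsub>G\<^esub> z" using K(3) L(3) xy z by auto
    then obtain k l where kl: "k \<in> K" "z = k \<otimes>\<^bsub>G\<^esub> x" "l \<in> L" "y = l \<otimes>\<^bsub>G\<^esub> z"
      by (auto simp: r_coset_def)
    have "k \<in> carrier G" "l \<in> carrier G" "x \<in> carrier G" using kl K L X_subset xy by auto
    hence "y = (l \<otimes>\<^bsub>G\<^esub> k) \<otimes>\<^bsub>G\<^esub> x" using kl by (simp add: G.m_assoc)
    thus "y \<in> (L <#>\<^bsub>G\<^esub> K) #>\<^bsub>G\<^esub> x" using kl by (auto simp: r_coset_def set_mult_def)
  qed
  thus ?thesis by (simp add: translation_ring_def)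
qed

lemma mult_assoc:
  assumes M: "M \<in> carrier T" and N: "N \<in> carrier T" and P: "P \<in> carrier T"
  shows "(M \<otimes>\<^bsub>T\<^esub> N) \<otimes>\<^bsub>T\<^esub> P = M \<otimes>\<^bsub>T\<^esub> (N \<otimes>\<^bsub>T\<^esub> P)"
proof (rule entry_eqI)
  fix x y assume xy: "x \<in> X" "y \<in> X"
  define Z where "Z = {z \<in> X. M (x, z) \<noteq> \<zero>\<^bsub>R\<^esub>}"
  define W where "W = (\<Union>z\<in>Z. {w \<in> X. N (z, w) \<noteq> \<zero>\<^bsub>R\<^esub>})"
  have Z: "finite Z" "Z \<subseteq> X" using finite_row[OF M xy(1)] by (auto simp: Z_def)
  have W: "finite W" "W \<subseteq> X" using Z finite_row[OF N] by (auto simp: W_def)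
  have MN: "(M \<otimes>\<^bsub>T\<^esub> N) (x, w) = (\<Oplus>\<^bsub>R\<^esub>z\<in>Z. M (x, z) \<otimes>\<^bsub>R\<^esub> N (z, w))" if "w \<in> X" for w
    using Z by (intro mult_entry M N xy that) (auto simp: Z_def)
  have NP: "(N \<otimes>\<^bsub>T\<^esub> P) (z, y) = (\<Oplus>\<^bsub>R\<^esub>w\<in>W. N (z, w) \<otimes>\<^bsub>R\<^esub> P (w, y))" if "z \<in> Z" for z
    using Z W that by (intro mult_entry N P xy) (auto simp: W_def)
  have cM: "M (x, z) \<in> carrier R" if "z \<in> Z" for z using that Z by (intro entry_closed[OF M] xy) auto
  have cN: "N (z, w) \<in> carrier R" if "z \<in> Z" "w \<in> W" for z w using that Z W by (intro entry_closed[OF N]) auto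
  have cP: "P (w, y) \<in> carrier R" if "w \<in> W" for w using that W by (intro entry_closed[OF P] xy) auto
  have "((M \<otimes>\<^bsub>T\<^esub> N) \<otimes>\<^bsub>T\<^esub> P) (x, y) = (\<Oplus>\<^bsub>R\<^esub>w\<in>W. (M \<otimes>\<^bsub>T\<^esub> N) (x, w) \<otimes>\<^bsub>R\<^esub> P (w, y))"
  proof (rule mult_entry[OF mult_closed[OF M N] P xy W])
    fix w assume w: "w \<in> X" "(M \<otimes>\<^bsub>T\<^esub> N) (x, w) \<noteq> \<zero>\<^bsub>R\<^esub>"
    show "w \<in> W"
    proof (rule ccontr)
      assume "w \<notin> W"
      hence "N (z, w) = \<zero>\<^bsub>R\<^esub>" if "z \<in> Z" for z using that w(1) by (auto simp: W_def)
      hence "(\<Oplus>\<^bsub>R\<^esub>z\<in>Z. M (x, z) \<otimes>\<^bsub>R\<^esub> N (z, w)) = \<zero>\<^bsub>R\<^esub>"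
        using cM by (intro R.add.finprod_one_eqI) auto
      thus False using w MN by simp
    qed
  qed
  also have "\<dots> = (\<Oplus>\<^bsub>R\<^esub>w\<in>W. \<Oplus>\<^bsub>R\<^esub>z\<in>Z. M (x, z) \<otimes>\<^bsub>R\<^esub> (N (z, w) \<otimes>\<^bsub>R\<^esub> P (w, y)))"
  proof (intro R.finsum_cong' refl)
    fix w assume w: "w \<in> W"
    have "(M \<otimes>\<^bsub>T\<^esub> N) (x, w) \<otimes>\<^bsub>R\<^esub> P (w, y) = (\<Oplus>\<^bsub>R\<^esub>z\<in>Z. (M (x, z) \<otimes>\<^bsub>R\<^esub> N (z, w)) \<otimes>\<^bsub>R\<^esub> P (w, y))"
      using W w Z cM cN cP by (subst MN, blast, intro R.finsum_ldistr) auto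
    also have "\<dots> = (\<Oplus>\<^bsub>R\<^esub>z\<in>Z. M (x, z) \<otimes>\<^bsub>R\<^esub> (N (z, w) \<otimes>\<^bsub>R\<^esub> P (w, y)))"
      using cM cN cP w by (intro R.finsum_cong' refl) (auto simp: R.m_assoc)
    finally show "(M \<otimes>\<^bsub>T\<^esub> N) (x, w) \<otimes>\<^bsub>R\<^esub> P (w, y) =
        (\<Oplus>\<^bsub>R\<^esub>z\<in>Z. M (x, z) \<otimes>\<^bsub>R\<^esub> (N (z, w) \<otimes>\<^bsub>R\<^esub> P (w, y)))" .
  qed (use cM cN cP in \<open>auto intro!: R.finsum_closed\<close>)
  also have "\<dots> = (\<Oplus>\<^bsub>R\<^esub>z\<in>Z. \<Oplus>\<^bsub>R\<^esub>w\<in>W. M (x, z) \<otimes>\<^bsub>R\<^esub> (N (z, w) \<otimes>\<^bsub>R\<^esub> P (w, y)))"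
    using Z W cM cN cP by (intro R.finsum_swap) auto
  also have "\<dots> = (\<Oplus>\<^bsub>R\<^esub>z\<in>Z. M (x, z) \<otimes>\<^bsub>R\<^esub> (N \<otimes>\<^bsub>T\<^esub> P) (z, y))"
  proof (intro R.finsum_cong' refl)
    fix z assume z: "z \<in> Z"
    show "(\<Oplus>\<^bsub>R\<^esub>w\<in>W. M (x, z) \<otimes>\<^bsub>R\<^esub> (N (z, w) \<otimes>\<^bsub>R\<^esub> P (w, y))) = M (x, z) \<otimes>\<^bsub>R\<^esub> (N \<otimes>\<^bsub>T\<^esub> P) (z, y)"
      using z W cM cN cP by (subst NP, blast, intro R.finsum_rdistr[symmetric]) auto
  qed (use Z cM mult_closed[OF N P] xy entry_closed in auto)
  also have "\<dots> = (M \<otimes>\<^bsub>T\<^esub> (N \<otimes>\<^bsub>T\<^esub> P)) (x, y)"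
    using Z by (intro mult_entry[symmetric] M mult_closed N P xy) (auto simp: Z_def)
  finally show "((M \<otimes>\<^bsub>T\<^esub> N) \<otimes>\<^bsub>T\<^esub> P) (x, y) = (M \<otimes>\<^bsub>T\<^esub> (N \<otimes>\<^bsub>T\<^esub> P)) (x, y)" .
qed (intro mult_closed M N P)+

lemma diag_mult:
  assumes r: "r \<in> carrier R" and N: "N \<in> carrier T" and xy: "x \<in> X" "y \<in> X"
  shows "((\<lambda>(x, y)\<in>X \<times> X. if x = y then r else \<zero>\<^bsub>R\<^esub>) \<otimes>\<^bsub>T\<^esub> N) (x, y) = r \<otimes>\<^bsub>R\<^esub> N (x, y)"
proof -
  let ?D = "(\<lambda>(x, y)\<in>X \<times> X. if x = y then r else \<zero>\<^bsub>R\<^esub>)"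
  have "(?D \<otimes>\<^bsub>T\<^esub> N) (x, y) = (\<Oplus>\<^bsub>R\<^esub>z\<in>{x}. ?D (x, z) \<otimes>\<^bsub>R\<^esub> N (z, y))"
    using xy by (intro mult_entry diag_closed r N) (auto split: if_splits)
  thus ?thesis using xy r N entry_closed by simp
qed

lemma mult_one:
  assumes M: "M \<in> carrier T"
  shows "M \<otimes>\<^bsub>T\<^esub> \<one>\<^bsub>T\<^esub> = M"
proof (rule entry_eqI)
  fix x y assume xy: "x \<in> X" "y \<in> X"
  define Z where "Z = insert y {z \<in> X. M (x, z) \<noteq> \<zero>\<^bsub>R\<^esub>}"
  have Z: "finite Z" "Z \<subseteq> X" using finite_row[OF M xy(1)] xy by (auto simp: Z_def)
  have c: "M (x, z) \<in> carrier R" if "z \<in> Z" for z using that Z by (intro entry_closed[OF M] xy) auto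
  have "(M \<otimes>\<^bsub>T\<^esub> \<one>\<^bsub>T\<^esub>) (x, y) = (\<Oplus>\<^bsub>R\<^esub>z\<in>Z. M (x, z) \<otimes>\<^bsub>R\<^esub> \<one>\<^bsub>T\<^esub> (z, y))"
    using Z by (intro mult_entry M one_closed xy) (auto simp: Z_def)
  also have "\<dots> = (\<Oplus>\<^bsub>R\<^esub>z\<in>Z. if y = z then M (x, z) else \<zero>\<^bsub>R\<^esub>)"
    using Z xy c by (intro R.finsum_cong' refl) (auto simp: one_entry subset_iff)
  also have "\<dots> = M (x, y)" using Z c by (intro R.finsum_singleton) (auto simp: Z_def)
  finally show "(M \<otimes>\<^bsub>T\<^esub> \<one>\<^bsub>T\<^esub>) (x, y) = M (x, y)" .
qed (intro mult_closed M one_closed)+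

lemma one_mult:
  assumes M: "M \<in> carrier T"
  shows "\<one>\<^bsub>T\<^esub> \<otimes>\<^bsub>T\<^esub> M = M"
proof (rule entry_eqI)
  fix x y assume xy: "x \<in> X" "y \<in> X"
  have "\<one>\<^bsub>T\<^esub> = (\<lambda>(x, y)\<in>X \<times> X. if x = y then \<one>\<^bsub>R\<^esub> else \<zero>\<^bsub>R\<^esub>)" by (simp add: translation_ring_def)
  thus "(\<one>\<^bsub>T\<^esub> \<otimes>\<^bsub>T\<^esub> M) (x, y) = M (x, y)"
    using diag_mult[of "\<one>\<^bsub>R\<^esub>" M x y] M xy entry_closed by simp
qed (intro mult_closed M one_closed)+

lemma distr_left:
  assumes M: "M \<in> carrier T" and N: "N \<in> carrier T" and P: "P \<in> carrier T"
  shows "(M \<oplus>\<^bsub>T\<^esub> N) \<otimes>\<^bsub>T\<^esub> P = (M \<otimes>\<^bsub>T\<^esub> P) \<oplus>\<^bsub>T\<^esub> (N \<otimes>\<^bsub>T\<^esub> P)"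
proof (rule entry_eqI)
  fix x y assume xy: "x \<in> X" "y \<in> X"
  define Z where "Z = {z \<in> X. M (x, z) \<noteq> \<zero>\<^bsub>R\<^esub>} \<union> {z \<in> X. N (x, z) \<noteq> \<zero>\<^bsub>R\<^esub>}"
  have Z: "finite Z" "Z \<subseteq> X" using finite_row[OF M xy(1)] finite_row[OF N xy(1)] by (auto simp: Z_def)
  have c: "M (x, z) \<in> carrier R" "N (x, z) \<in> carrier R" "P (z, y) \<in> carrier R" if "z \<in> Z" for z
    using that Z xy M N P by (auto intro!: entry_closed)
  have "((M \<oplus>\<^bsub>T\<^esub> N) \<otimes>\<^bsub>T\<^esub> P) (x, y) = (\<Oplus>\<^bsub>R\<^esub>z\<in>Z. (M \<oplus>\<^bsub>T\<^esub> N) (x, z) \<otimes>\<^bsub>R\<^esub> P (z, y))"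
    using Z xy by (intro mult_entry add_closed M N P xy) (auto simp: Z_def add_entry)
  also have "\<dots> = (\<Oplus>\<^bsub>R\<^esub>z\<in>Z. M (x, z) \<otimes>\<^bsub>R\<^esub> P (z, y) \<oplus>\<^bsub>R\<^esub> N (x, z) \<otimes>\<^bsub>R\<^esub> P (z, y))"
    using Z xy c by (intro R.finsum_cong' refl) (auto simp: add_entry R.l_distr subset_iff)
  also have "\<dots> = (\<Oplus>\<^bsub>R\<^esub>z\<in>Z. M (x, z) \<otimes>\<^bsub>R\<^esub> P (z, y)) \<oplus>\<^bsub>R\<^esub> (\<Oplus>\<^bsub>R\<^esub>z\<in>Z. N (x, z) \<otimes>\<^bsub>R\<^esub> P (z, y))"
    using c by (intro R.finsum_addf) auto
  also have "(\<Oplus>\<^bsub>R\<^esub>z\<in>Z. M (x, z) \<otimes>\<^bsub>R\<^esub> P (z, y)) = (M \<otimes>\<^bsub>T\<^esub> P) (x, y)"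
    using Z by (intro mult_entry[symmetric] M P xy) (auto simp: Z_def)
  also have "(\<Oplus>\<^bsub>R\<^esub>z\<in>Z. N (x, z) \<otimes>\<^bsub>R\<^esub> P (z, y)) = (N \<otimes>\<^bsub>T\<^esub> P) (x, y)"
    using Z by (intro mult_entry[symmetric] N P xy) (auto simp: Z_def)
  finally show "((M \<oplus>\<^bsub>T\<^esub> N) \<otimes>\<^bsub>T\<^esub> P) (x, y) = ((M \<otimes>\<^bsub>T\<^esub> P) \<oplus>\<^bsub>T\<^esub> (N \<otimes>\<^bsub>T\<^esub> P)) (x, y)"
    using xy by (simp add: add_entry)
qed (intro mult_closed add_closed M N P)+

lemma distr_right:
  assumes M: "M \<in> carrier T" and N: "N \<in> carrier T" and P: "P \<in> carrier T"
  shows "P \<otimes>\<^bsub>T\<^esub> (M \<oplus>\<^bsub>T\<^esub> N) = (P \<otimes>\<^bsub>T\<^esub> M) \<oplus>\<^bsub>T\<^esub> (P \<otimes>\<^bsub>T\<^esub> N)"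
proof (rule entry_eqI)
  fix x y assume xy: "x \<in> X" "y \<in> X"
  define Z where "Z = {z \<in> X. P (x, z) \<noteq> \<zero>\<^bsub>R\<^esub>}"
  have Z: "finite Z" "Z \<subseteq> X" using finite_row[OF P xy(1)] by (auto simp: Z_def)
  have c: "M (z, y) \<in> carrier R" "N (z, y) \<in> carrier R" "P (x, z) \<in> carrier R" if "z \<in> Z" for z
    using that Z xy M N P by (auto intro!: entry_closed)
  have ent: "(P \<otimes>\<^bsub>T\<^esub> Q) (x, y) = (\<Oplus>\<^bsub>R\<^esub>z\<in>Z. P (x, z) \<otimes>\<^bsub>R\<^esub> Q (z, y))" if "Q \<in> carrier T" for Q
    using Z by (intro mult_entry P that xy) (auto simp: Z_def)
  have "(P \<otimes>\<^bsub>T\<^esub> (M \<oplus>\<^bsub>T\<^esub> N)) (x, y) = (\<Oplus>\<^bsub>R\<^esub>z\<in>Z. P (x, z) \<otimes>\<^bsub>R\<^esub> (M \<oplus>\<^bsub>T\<^esub> N) (z, y))"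
    by (intro ent add_closed M N)
  also have "\<dots> = (\<Oplus>\<^bsub>R\<^esub>z\<in>Z. P (x, z) \<otimes>\<^bsub>R\<^esub> M (z, y) \<oplus>\<^bsub>R\<^esub> P (x, z) \<otimes>\<^bsub>R\<^esub> N (z, y))"
    using Z xy c by (intro R.finsum_cong' refl) (auto simp: add_entry R.r_distr subset_iff)
  also have "\<dots> = (\<Oplus>\<^bsub>R\<^esub>z\<in>Z. P (x, z) \<otimes>\<^bsub>R\<^esub> M (z, y)) \<oplus>\<^bsub>R\<^esub> (\<Oplus>\<^bsub>R\<^esub>z\<in>Z. P (x, z) \<otimes>\<^bsub>R\<^esub> N (z, y))"
    using c by (intro R.finsum_addf) auto
  finally show "(P \<otimes>\<^bsub>T\<^esub> (M \<oplus>\<^bsub>T\<^esub> N)) (x, y) = ((P \<otimes>\<^bsub>T\<^esub> M) \<oplus>\<^bsub>T\<^esub> (P \<otimes>\<^bsub>T\<^esub> N)) (x, y)"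
    using xy ent[OF M] ent[OF N] by (simp add: add_entry)
qed (intro mult_closed add_closed M N P)+

lemma ring_T: "ring T"
proof (rule ringI)
  show "abelian_group T"
  proof (rule abelian_groupI)
    fix M N P assume c: "M \<in> carrier T" "N \<in> carrier T" "P \<in> carrier T"
    show "M \<oplus>\<^bsub>T\<^esub> N \<oplus>\<^bsub>T\<^esub> P = M \<oplus>\<^bsub>T\<^esub> (N \<oplus>\<^bsub>T\<^esub> P)"
      by (rule entry_eqI) (use c in \<open>auto intro!: add_closed simp: add_entry entry_closed R.a_assoc\<close>)
  next
    fix M N assume c: "M \<in> carrier T" "N \<in> carrier T"
    show "M \<oplus>\<^bsub>T\<^esub> N = N \<oplus>\<^bsub>T\<^esub> M"
      by (rule entry_eqI) (use c in \<open>auto intro!: add_closed simp: add_entry entry_closed R.a_comm\<close>)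
  next
    fix M assume c: "M \<in> carrier T"
    show "\<zero>\<^bsub>T\<^esub> \<oplus>\<^bsub>T\<^esub> M = M"
      by (rule entry_eqI)
        (use c in \<open>auto intro!: add_closed zero_closed simp: add_entry zero_entry entry_closed\<close>)
    have "(\<lambda>(x, y)\<in>X \<times> X. \<ominus>\<^bsub>R\<^esub> M (x, y)) \<oplus>\<^bsub>T\<^esub> M = \<zero>\<^bsub>T\<^esub>"
      by (rule entry_eqI)
        (use c in \<open>auto intro!: add_closed uminus_closed zero_closed
            simp: add_entry zero_entry entry_closed R.l_neg\<close>)
    thus "\<exists>N\<in>carrier T. N \<oplus>\<^bsub>T\<^esub> M = \<zero>\<^bsub>T\<^esub>" using uminus_closed[OF c] by blast
  qed (intro add_closed zero_closed; assumption)+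
  show "Group.monoid T"
    by (rule monoidI) (auto intro!: mult_closed one_closed mult_assoc one_mult mult_one)
qed (intro distr_left distr_right; assumption)+

sublocale T: ring T by (rule ring_T)

lemma finsum_entry:
  assumes "finite I" "\<And>i. i \<in> I \<Longrightarrow> f i \<in> carrier T" "x \<in> X" "y \<in> X"
  shows "(\<Oplus>\<^bsub>T\<^esub>i\<in>I. f i) (x, y) = (\<Oplus>\<^bsub>R\<^esub>i\<in>I. f i (x, y))"
  using assms(1,2)
proof (induction I)
  case (insert i I)
  have "(\<Oplus>\<^bsub>T\<^esub>i\<in>insert i I. f i) = f i \<oplus>\<^bsub>T\<^esub> (\<Oplus>\<^bsub>T\<^esub>i\<in>I. f i)"
    using insert by (intro T.finsum_insert) auto
  moreover have "(\<Oplus>\<^bsub>R\<^esub>i\<in>insert i I. f i (x, y)) = f i (x, y) \<oplus>\<^bsub>R\<^esub> (\<Oplus>\<^bsub>R\<^esub>i\<in>I. f i (x, y))"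
    using insert assms(3,4) by (intro R.finsum_insert) (auto simp: entry_closed)
  ultimately show ?case using insert assms(3,4) by (simp add: add_entry)
qed (use assms(3,4) in \<open>simp add: zero_entry\<close>)

text \<open>The scalar matrices embed \<open>R\<close> into the translation ring.\<close>

lemma diag_ring_hom:
  "(\<lambda>r. \<lambda>(x, y)\<in>X \<times> X. if x = y then r else \<zero>\<^bsub>R\<^esub>) \<in> ring_hom R T"
proof (rule ring_hom_memI)
  fix r s assume rs: "r \<in> carrier R" "s \<in> carrier R"
  show "(\<lambda>(x, y)\<in>X \<times> X. if x = y then r \<otimes>\<^bsub>R\<^esub> s else \<zero>\<^bsub>R\<^esub>) =
    (\<lambda>(x, y)\<in>X \<times> X. if x = y then r else \<zero>\<^bsub>R\<^esub>) \<otimes>\<^bsub>T\<^esub> (\<lambda>(x, y)\<in>X \<times> X. if x = y then s else \<zero>\<^bsub>R\<^esub>)"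
    by (rule entry_eqI)
      (use rs in \<open>auto intro!: mult_closed diag_closed simp: diag_mult[OF _ diag_closed]\<close>)
  show "(\<lambda>(x, y)\<in>X \<times> X. if x = y then r \<oplus>\<^bsub>R\<^esub> s else \<zero>\<^bsub>R\<^esub>) =
    (\<lambda>(x, y)\<in>X \<times> X. if x = y then r else \<zero>\<^bsub>R\<^esub>) \<oplus>\<^bsub>T\<^esub> (\<lambda>(x, y)\<in>X \<times> X. if x = y then s else \<zero>\<^bsub>R\<^esub>)"
    by (rule entry_eqI) (use rs in \<open>auto intro!: add_closed diag_closed simp: add_entry\<close>)
next
  show "(\<lambda>(x, y)\<in>X \<times> X. if x = y then \<one>\<^bsub>R\<^esub> else \<zero>\<^bsub>R\<^esub>) = \<one>\<^bsub>T\<^esub>"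
    by (simp add: translation_ring_def)
qed (rule diag_closed)

end

section \<open>UGN of the translation ring\<close>

context translation
begin

lemma UGN_T_imp_UGN_R:
  assumes "UGN T"
  shows "UGN R"
proof (rule ccontr)
  assume "\<not> UGN R"
  then obtain n :: nat where n: "n > 0" "matrix_retract R {..<n + 1} {..<n}"
    using R.UGN_iff by blast
  have "matrix_retract T {..<n + 1} {..<n}"
    by (rule retract_ring_hom[OF R.ring_axioms ring_T diag_ring_hom n(2)])
  thus False using assms n(1) T.UGN_iff by blast
qed

text \<open>Matrices \<open>A\<close>, \<open>B\<close> over \<open>T\<close> with \<open>A B = 1\<close> are matrices over \<open>R\<close> with rows and columns indexed by
  copies of \<open>X\<close>. Restricting the rows of \<open>A\<close> and the columns of \<open>B\<close> to a Folner set \<open>F\<close>, only the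
  intermediate indices in the neighbourhood \<open>N\<close> of \<open>F\<close> contribute, and there are too few of them if
  \<open>R\<close> has UGN.\<close>

lemma retract_T_imp_compresses:
  assumes ret: "matrix_retract T {..<n + 1} {..<n}" and n: "n > 0" and UGN: "UGN R"
  shows "compresses G X n"
proof (rule ccontr)
  assume nc: "\<not> compresses G X n"
  obtain A B where c: "\<And>i j. i < n + 1 \<Longrightarrow> j < n \<Longrightarrow> A i j \<in> carrier T \<and> B j i \<in> carrier T"
    and AB: "\<And>i k. i < n + 1 \<Longrightarrow> k < n + 1 \<Longrightarrow>
      (\<Oplus>\<^bsub>T\<^esub>j\<in>{..<n}. A i j \<otimes>\<^bsub>T\<^esub> B j k) = (if i = k then \<one>\<^bsub>T\<^esub> else \<zero>\<^bsub>T\<^esub>)"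
    using ret unfolding matrix_retract_def Ball_def lessThan_iff by blast
  have "\<exists>K. finite K \<and> K \<subseteq> carrier G \<and>
      (\<forall>x\<in>X. \<forall>y\<in>X. A i j (x, y) \<noteq> \<zero>\<^bsub>R\<^esub> \<longrightarrow> y \<in> K #>\<^bsub>G\<^esub> x)" if "i < n + 1" "j < n" for i j
    using bandE[of "A i j"] c[OF that] by metis
  then obtain L where L: "\<And>i j. i < n + 1 \<Longrightarrow> j < n \<Longrightarrow> finite (L i j) \<and> L i j \<subseteq> carrier G \<and>
      (\<forall>x\<in>X. \<forall>y\<in>X. A i j (x, y) \<noteq> \<zero>\<^bsub>R\<^esub> \<longrightarrow> y \<in> L i j #>\<^bsub>G\<^esub> x)" by metis
  \<comment> \<open>The unit of \<open>G\<close> is included so that \<open>F \<subseteq> N\<close>, which makes \<open>N\<close> nonempty.\<close>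
  define K where "K = insert \<one>\<^bsub>G\<^esub> (\<Union>i<n+1. \<Union>j<n. L i j)"
  have K: "finite K" "K \<subseteq> carrier G" using L by (auto simp: K_def)
  obtain F where F: "F \<subseteq> X" "finite F"
    and lt: "n * card (neighbourhood G X K F) < (n + 1) * card F"
    using folner_set[OF nc K] by blast
  define N where "N = neighbourhood G X K F"
  have N: "finite N" "N \<subseteq> X"
    using finite_neighbourhood[OF K(1) F(2)] by (auto simp: N_def neighbourhood_def)
  have FN: "F \<subseteq> N"
  proof
    fix x assume "x \<in> F"
    moreover have "x = \<one>\<^bsub>G\<^esub> \<otimes>\<^bsub>G\<^esub> x" using \<open>x \<in> F\<close> F X_subset by auto
    ultimately show "x \<in> N" using F unfolding N_def neighbourhood_def K_def r_coset_def by blast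
  qed
  have "matrix_retract R (F \<times> {..<n + 1}) (N \<times> {..<n})"
    unfolding matrix_retract_def
  proof (rule exI[of _ "\<lambda>p q. A (snd p) (snd q) (fst p, fst q)"],
      rule exI[of _ "\<lambda>q p. B (snd q) (snd p) (fst q, fst p)"], intro conjI ballI)
    fix p q assume "p \<in> F \<times> {..<n + 1}" "q \<in> N \<times> {..<n}"
    hence "fst p \<in> X" "fst q \<in> X" "snd p < n + 1" "snd q < n" using F N by auto
    thus "A (snd p) (snd q) (fst p, fst q) \<in> carrier R" "B (snd q) (snd p) (fst q, fst p) \<in> carrier R"
      using c entry_closed by blast+
  next
    fix p q assume p: "p \<in> F \<times> {..<n + 1}" and q: "q \<in> F \<times> {..<n + 1}"
    obtain x i y k where pq: "p = (x, i)" "q = (y, k)" by (cases p, cases q) blast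
    have xy: "x \<in> X" "y \<in> X" and ik: "i < n + 1" "k < n + 1" and xF: "x \<in> F"
      using p q F by (auto simp: pq)
    have ABc: "A i j (x, z) \<otimes>\<^bsub>R\<^esub> B j k (z, y) \<in> carrier R" if "z \<in> N" "j < n" for z j
      using that c ik xy N entry_closed by (intro R.m_closed) blast+
    have "(\<Oplus>\<^bsub>R\<^esub>r\<in>N \<times> {..<n}. A (snd p) (snd r) (fst p, fst r) \<otimes>\<^bsub>R\<^esub> B (snd r) (snd q) (fst r, fst q)) =
        (\<Oplus>\<^bsub>R\<^esub>z\<in>N. \<Oplus>\<^bsub>R\<^esub>j\<in>{..<n}. A i j (x, z) \<otimes>\<^bsub>R\<^esub> B j k (z, y))"
      using N ABc by (subst R.finsum_cartesian_product) (auto simp: pq)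
    also have "\<dots> = (\<Oplus>\<^bsub>R\<^esub>j\<in>{..<n}. \<Oplus>\<^bsub>R\<^esub>z\<in>N. A i j (x, z) \<otimes>\<^bsub>R\<^esub> B j k (z, y))"
      using N ABc by (intro R.finsum_swap) auto
    also have "\<dots> = (\<Oplus>\<^bsub>R\<^esub>j\<in>{..<n}. (A i j \<otimes>\<^bsub>T\<^esub> B j k) (x, y))"
    proof (intro R.finsum_cong' refl)
      fix j assume j: "j \<in> {..<n}"
      show "(\<Oplus>\<^bsub>R\<^esub>z\<in>N. A i j (x, z) \<otimes>\<^bsub>R\<^esub> B j k (z, y)) = (A i j \<otimes>\<^bsub>T\<^esub> B j k) (x, y)"
      proof (rule mult_entry[symmetric])
        fix z assume z: "z \<in> X" "A i j (x, z) \<noteq> \<zero>\<^bsub>R\<^esub>"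
        hence "z \<in> L i j #>\<^bsub>G\<^esub> x" using L ik j xy by blast
        hence "z \<in> K #>\<^bsub>G\<^esub> x" using ik j by (auto simp: K_def r_coset_def)
        thus "z \<in> N" using z xF by (auto simp: N_def neighbourhood_def)
      qed (use c ik j xy N in auto)
    next
      have "A i j \<otimes>\<^bsub>T\<^esub> B j k \<in> carrier T" if "j < n" for j
        using that c ik mult_closed by blast
      thus "(\<lambda>j. (A i j \<otimes>\<^bsub>T\<^esub> B j k) (x, y)) \<in> {..<n} \<rightarrow> carrier R" using xy entry_closed by auto
    qed
    also have "\<dots> = (\<Oplus>\<^bsub>T\<^esub>j\<in>{..<n}. A i j \<otimes>\<^bsub>T\<^esub> B j k) (x, y)"
      using c ik xy mult_closed by (intro finsum_entry[symmetric]) auto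
    also have "\<dots> = (if p = q then \<one>\<^bsub>R\<^esub> else \<zero>\<^bsub>R\<^esub>)"
      using AB[OF ik] xy by (auto simp: pq one_entry zero_entry)
    finally show "(\<Oplus>\<^bsub>R\<^esub>r\<in>N \<times> {..<n}. A (snd p) (snd r) (fst p, fst r) \<otimes>\<^bsub>R\<^esub> B (snd r) (snd q) (fst r, fst q)) =
        (if p = q then \<one>\<^bsub>R\<^esub> else \<zero>\<^bsub>R\<^esub>)" .
  qed
  moreover have "F \<noteq> {}" using lt by auto
  hence "N \<times> {..<n} \<noteq> {}" using FN n by auto
  moreover have "card (N \<times> {..<n}) < card (F \<times> {..<n + 1})"
    using lt by (simp add: card_cartesian_product N_def mult.commute)
  ultimately have "\<not> UGN R" using F(2) N(1)
    by (intro R.retract_imp_not_UGN[of "F \<times> {..<n + 1}" "N \<times> {..<n}"]) simp_all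
  thus False using UGN by simp
qed

text \<open>The incidence matrix \<open>A\<close> of a compressing map and its transpose \<open>B\<close> satisfy \<open>A B = 1\<close>, as the
  map is injective.\<close>

lemma compresses_imp_not_UGN:
  assumes comp: "compresses G X n" and ne: "X \<noteq> {}"
  shows "\<not> UGN T"
proof -
  obtain K f where K: "finite K" "K \<subseteq> carrier G" and inj: "inj_on f (X \<times> {..n})"
    and f: "\<And>x i. x \<in> X \<Longrightarrow> i \<le> n \<Longrightarrow> f (x, i) \<in> (X \<inter> (K #>\<^bsub>G\<^esub> x)) \<times> {..<n}"
    using comp unfolding compresses_def by blast
  have n: "n > 0"
  proof -
    obtain x where "x \<in> X" using ne by blast
    thus ?thesis using f[of x 0] by auto
  qed
  define A where "A i j = (\<lambda>(x, y)\<in>X \<times> X. if f (x, i) = (y, j) then \<one>\<^bsub>R\<^esub> else \<zero>\<^bsub>R\<^esub>)" for i j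
  define B where "B j i = (\<lambda>(y, x)\<in>X \<times> X. if f (x, i) = (y, j) then \<one>\<^bsub>R\<^esub> else \<zero>\<^bsub>R\<^esub>)" for j i
  have A: "A i j \<in> carrier T" if i: "i \<le> n" for i j
    unfolding A_def
  proof (rule carrier_memI[OF _ K])
    fix x y assume "x \<in> X" "(if f (x, i) = (y, j) then \<one>\<^bsub>R\<^esub> else \<zero>\<^bsub>R\<^esub>) \<noteq> \<zero>\<^bsub>R\<^esub>"
    thus "y \<in> K #>\<^bsub>G\<^esub> x" using f[of x i] i by (auto split: if_splits)
  qed auto
  have B: "B j i \<in> carrier T" if i: "i \<le> n" for i j
    unfolding B_def
  proof (rule carrier_memI)
    show "finite ((\<lambda>k. inv\<^bsub>G\<^esub> k) ` K)" "(\<lambda>k. inv\<^bsub>G\<^esub> k) ` K \<subseteq> carrier G" using K by auto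
    fix y x assume xy: "y \<in> X" "x \<in> X" "(if f (x, i) = (y, j) then \<one>\<^bsub>R\<^esub> else \<zero>\<^bsub>R\<^esub>) \<noteq> \<zero>\<^bsub>R\<^esub>"
    hence "y \<in> K #>\<^bsub>G\<^esub> x" using f[of x i] i by (auto split: if_splits)
    then obtain k where k: "k \<in> K" "y = k \<otimes>\<^bsub>G\<^esub> x" by (auto simp: r_coset_def)
    have "k \<in> carrier G" "x \<in> carrier G" using k(1) K xy(2) X_subset by auto
    hence "x = inv\<^bsub>G\<^esub> k \<otimes>\<^bsub>G\<^esub> y" unfolding k(2) by (simp flip: G.m_assoc)
    thus "x \<in> ((\<lambda>k. inv\<^bsub>G\<^esub> k) ` K) #>\<^bsub>G\<^esub> y" using k(1) unfolding r_coset_def by blast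
  qed auto
  have AB: "(\<Oplus>\<^bsub>T\<^esub>j\<in>{..<n}. A i j \<otimes>\<^bsub>T\<^esub> B j k) = (if i = k then \<one>\<^bsub>T\<^esub> else \<zero>\<^bsub>T\<^esub>)"
    if ik: "i \<le> n" "k \<le> n" for i k
  proof (rule entry_eqI)
    show "(\<Oplus>\<^bsub>T\<^esub>j\<in>{..<n}. A i j \<otimes>\<^bsub>T\<^esub> B j k) \<in> carrier T"
      using A B ik by (intro T.finsum_closed) auto
    show "(if i = k then \<one>\<^bsub>T\<^esub> else \<zero>\<^bsub>T\<^esub>) \<in> carrier T" by simp
    fix x y assume xy: "x \<in> X" "y \<in> X"
    obtain z0 j0 where f0: "f (x, i) = (z0, j0)" by fastforce
    have z0: "z0 \<in> X" "j0 < n" using f[OF xy(1) ik(1)] f0 by auto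
    have "(A i j \<otimes>\<^bsub>T\<^esub> B j k) (x, y) = (if j0 = j then (if f (y, k) = (z0, j) then \<one>\<^bsub>R\<^esub> else \<zero>\<^bsub>R\<^esub>) else \<zero>\<^bsub>R\<^esub>)"
      for j
    proof -
      have "(A i j \<otimes>\<^bsub>T\<^esub> B j k) (x, y) = (\<Oplus>\<^bsub>R\<^esub>z\<in>{z0}. A i j (x, z) \<otimes>\<^bsub>R\<^esub> B j k (z, y))"
        using z0 f0 xy by (intro mult_entry A B ik xy) (auto simp: A_def split: if_splits)
      thus ?thesis using xy z0 f0 by (simp add: A_def B_def)
    qed
    hence "(\<Oplus>\<^bsub>T\<^esub>j\<in>{..<n}. A i j \<otimes>\<^bsub>T\<^esub> B j k) (x, y) =
        (\<Oplus>\<^bsub>R\<^esub>j\<in>{..<n}. if j0 = j then (if f (y, k) = (z0, j) then \<one>\<^bsub>R\<^esub> else \<zero>\<^bsub>R\<^esub>) else \<zero>\<^bsub>R\<^esub>)"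
      using A B ik xy by (subst finsum_entry) auto
    also have "\<dots> = (if f (y, k) = (z0, j0) then \<one>\<^bsub>R\<^esub> else \<zero>\<^bsub>R\<^esub>)"
      using z0 by (intro R.finsum_singleton) auto
    also have "f (y, k) = (z0, j0) \<longleftrightarrow> x = y \<and> i = k"
    proof
      assume "f (y, k) = (z0, j0)"
      hence "f (y, k) = f (x, i)" using f0 by simp
      from inj_onD[OF inj this] show "x = y \<and> i = k" using xy ik by auto
    qed (use f0 in auto)
    finally show "(\<Oplus>\<^bsub>T\<^esub>j\<in>{..<n}. A i j \<otimes>\<^bsub>T\<^esub> B j k) (x, y) = (if i = k then \<one>\<^bsub>T\<^esub> else \<zero>\<^bsub>T\<^esub>) (x, y)"
      using xy by (auto simp: one_entry zero_entry)
  qed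
  have "matrix_retract T {..<n + 1} {..<n}"
    unfolding matrix_retract_def
    by (rule exI[of _ A], rule exI[of _ B]) (use A B AB in \<open>simp add: less_Suc_eq_le\<close>)
  thus ?thesis using n T.UGN_iff by blast
qed

end

section \<open>The field with two elements\<close>

text \<open>Over a finite nontrivial ring, \<open>R\<^sup>n\<close> has fewer elements than \<open>R\<^sup>n\<^sup>+\<^sup>1\<close>.\<close>

lemma finite_ring_UGN:
  assumes fin: "finite (carrier R)" and card: "card (carrier R) > 1"
  shows "UGN R"
  unfolding UGN_def
proof (intro allI impI notI)
  fix n :: nat
  assume "\<exists>f\<in>free_rmod_hom R n (n + 1). f ` free_rmod R n = free_rmod R (n + 1)"
  then obtain f where f: "f ` free_rmod R n = free_rmod R (n + 1)" by blast
  have c: "card (free_rmod R k) = card (carrier R) ^ k" for k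
    by (simp add: free_rmod_def card_PiE)
  have "finite (free_rmod R n)" using fin by (auto simp: free_rmod_def intro!: finite_PiE)
  hence "card (free_rmod R (n + 1)) \<le> card (free_rmod R n)"
    using card_image_le[of _ f] by (metis f)
  hence "card (carrier R) ^ (n + 1) \<le> card (carrier R) ^ n" unfolding c .
  from power_le_imp_le_exp[OF card this] show False by simp
qed

text \<open>The field with two elements, on two given elements of a type: \<open>a\<close> is zero and \<open>b\<close> is one.\<close>

definition two_element_ring :: "'r \<Rightarrow> 'r \<Rightarrow> 'r ring" where
  "two_element_ring a b = \<lparr>carrier = {a, b}, mult = (\<lambda>x y. if x = b \<and> y = b then b else a),
     one = b, zero = a, add = (\<lambda>x y. if x = y then a else b)\<rparr>"

lemma ring_two_element_ring:
  assumes "a \<noteq> b"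
  shows "ring (two_element_ring a b)"
proof (rule ringI)
  show "abelian_group (two_element_ring a b)"
    by (rule abelian_groupI) (use assms in \<open>auto simp: two_element_ring_def\<close>)
  show "Group.monoid (two_element_ring a b)"
    by (rule monoidI) (use assms in \<open>auto simp: two_element_ring_def\<close>)
qed (use assms in \<open>auto simp: two_element_ring_def\<close>)

lemma UGN_two_element_ring: "a \<noteq> b \<Longrightarrow> UGN (two_element_ring a b)"
  by (rule finite_ring_UGN) (auto simp: two_element_ring_def)

section \<open>Supramenability\<close>

theorem corollary3p6:
  fixes G :: "('g, 'm) monoid_scheme"
  assumes "group G"
    and "\<exists>a b :: 'r. a \<noteq> b"
  shows "supramenable G \<longleftrightarrow>
    (\<forall>(R :: 'r ring) X. ring R \<longrightarrow> X \<subseteq> carrier G \<longrightarrow> X \<noteq> {} \<longrightarrow>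
       (UGN (translation_ring G X R) \<longleftrightarrow> UGN R))"
proof
  assume sup: "supramenable G"
  show "\<forall>(R :: 'r ring) X. ring R \<longrightarrow> X \<subseteq> carrier G \<longrightarrow> X \<noteq> {} \<longrightarrow>
       (UGN (translation_ring G X R) \<longleftrightarrow> UGN R)"
  proof (intro allI impI)
    fix R :: "'r ring" and X
    assume R: "ring R" and X: "X \<subseteq> carrier G" "X \<noteq> {}"
    interpret translation G R X
      using assms(1) R X(1) by (simp add: translation_def translation_axioms_def)
    have "amenable_subset G X" using sup X by (simp add: supramenable_def)
    hence nc: "\<not> compresses G X n" for n
      using compresses_imp_not_amenable[OF assms(1) X(1)] by blast
    have "UGN T" if "UGN R"
      using retract_T_imp_compresses[OF _ _ that] nc T.UGN_iff by blast
    thus "UGN T \<longleftrightarrow> UGN R" using UGN_T_imp_UGN_R by blast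
  qed
next
  assume iff: "\<forall>(R :: 'r ring) X. ring R \<longrightarrow> X \<subseteq> carrier G \<longrightarrow> X \<noteq> {} \<longrightarrow>
       (UGN (translation_ring G X R) \<longleftrightarrow> UGN R)"
  obtain a b :: 'r where ab: "a \<noteq> b" using assms(2) by blast
  define R where "R = two_element_ring a b"
  have R: "ring R" "UGN R"
    using ring_two_element_ring[OF ab] UGN_two_element_ring[OF ab] by (simp_all add: R_def)
  show "supramenable G"
    unfolding supramenable_def
  proof (intro allI impI, rule ccontr)
    fix X assume X: "X \<subseteq> carrier G" "X \<noteq> {}" and na: "\<not> amenable_subset G X"
    interpret translation G R X
      using assms(1) R(1) X(1) by (simp add: translation_def translation_axioms_def)
    obtain n where "compresses G X n"
      using not_amenable_imp_compresses[OF assms(1) X(1) na] by blast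
    hence "\<not> UGN T" by (rule compresses_imp_not_UGN) (rule X(2))
    thus False using iff R X by blast
  qed
qed

end
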